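(* Let $n\ge2$, $1\le p,\tilde p<\infty$, let $\varphi:(0,\infty)\to(0,\infty)$, and let $\Phi$ be a radial function on $\mathbb{R}^n$. If $$\mathcal{K}_1=\omega_{n-1}\sup_{r>0}\frac1{\varphi(r)}\int_0^\infty\frac{|\Phi(t)|}{t}\varphi(r/t)\,dt<\infty,$$ then for every $f\in\varphi L^{p}_{\rm rad}L^{\tilde p}_{\rm ang}(\mathbb{R}^n)$, $$\|H_\Phi f\|_{\varphi L^{p}_{\rm rad}L^{\tilde p}_{\rm ang}(\mathbb{R}^n)}\le\mathcal{K}_1\,\|f\|_{\varphi L^{p}_{\rm rad}L^{\tilde p}_{\rm ang}(\mathbb{R}^n)} .$$
   Context: $S^{n-1}$ is the unit sphere of $\mathbb{R}^n$ with (unnormalized) surface Lebesgue measure $d\sigma$, $\omega_{n-1}=\sigma(S^{n-1})$, and $\nu_n$ is the volume of the unit ball of $\mathbb{R}^n$. The generalized mixed radial-angular central Morrey space $\varphi L^{p}_{\rm rad}L^{\tilde p}_{\rm ang}(\mathbb{R}^n)$ consists of the functions $f$ with $$\|f\|_{\varphi L^{p}_{\rm rad}L^{\tilde p}_{\rm ang}(\mathbb{R}^n)}=\sup_{r>0}\frac1{\varphi(r)}\Big(\frac1{\nu_nr^n}\int_0^r\Big(\int_{S^{n-1}}|f(\rho\theta)|^{\tilde p}d\sigma(\theta)\Big)^{p/\tilde p}\rho^{n-1}d\rho\Big)^{1/p}<\infty .$$ The Hausdorff operator is $$H_\Phi f(x)=\int_{\mathbb{R}^n}\frac{\Phi(x|y|^{-1})}{|y|^n}f(y)\,dy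 .$$ $\Phi$ is measurable; radial means $\Phi(x)$ depends only on $|x|$, and one writes $\Phi(t)$, $t>0$, for its value at points with $|x|=t$. *)

theory Defs
  imports "HOL-Analysis.Analysis"
begin

(* The unnormalized surface measure on the unit sphere, as the cone measure
   sigma(A) = n * vol {x. 0 < |x| < 1 and x / |x| in A}; recall sgn x = x / |x|.
   The completion makes it defined on all Lebesgue measurable subsets of the sphere. *)
definition surface_measure :: "'a::euclidean_space measure" where
  "surface_measure = completion
     (distr (scale_measure (of_nat DIM('a)) (restrict_space lborel (ball 0 1 - {0})))
            (restrict_space borel (sphere 0 1)) sgn)"

(* Powers with exponent a > 0 on [0, \<infinity>], with \<infinity> to the a equal to \<infinity>
   (enn2real sends \<infinity> to 0, hence the case distinction). *)
definition ennreal_powr :: "ennreal \<Rightarrow> real \<Rightarrow> ennreal" where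
  "ennreal_powr x a = (if x = \<infinity> then \<infinity> else ennreal (enn2real x powr a))"

definition morrey_norm ::
    "(real \<Rightarrow> real) \<Rightarrow> real \<Rightarrow> real \<Rightarrow> ('a::euclidean_space \<Rightarrow> complex) \<Rightarrow> ennreal" where
  "morrey_norm \<phi> p q f =
     (SUP r\<in>{0<..}. ennreal (1 / \<phi> r) *
        ennreal_powr
          (ennreal (1 / (measure lborel (ball (0::'a) 1) * r ^ DIM('a))) *
           (\<integral>\<^sup>+\<rho>\<in>{0<..<r}.
              ennreal_powr
                (\<integral>\<^sup>+\<theta>. ennreal (cmod (f (\<rho> *\<^sub>R \<theta>)) powr q) \<partial>surface_measure) (p / q)
              * ennreal (\<rho> ^ (DIM('a) - 1)) \<partial>lebesgue))
          (1 / p))"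

definition morrey_space ::
    "(real \<Rightarrow> real) \<Rightarrow> real \<Rightarrow> real \<Rightarrow> ('a::euclidean_space \<Rightarrow> complex) set" where
  "morrey_space \<phi> p q = {f. f \<in> borel_measurable lebesgue \<and> morrey_norm \<phi> p q f < \<infinity>}"

definition hausdorff_integrand ::
    "('a::euclidean_space \<Rightarrow> complex) \<Rightarrow> ('a \<Rightarrow> complex) \<Rightarrow> 'a \<Rightarrow> 'a \<Rightarrow> complex" where
  "hausdorff_integrand \<Phi> f x y =
     \<Phi> (inverse (norm y) *\<^sub>R x) / complex_of_real (norm y ^ DIM('a)) * f y"

definition hausdorff_op ::
    "('a::euclidean_space \<Rightarrow> complex) \<Rightarrow> ('a \<Rightarrow> complex) \<Rightarrow> 'a \<Rightarrow> complex" where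
  "hausdorff_op \<Phi> f x = (\<integral>y. hausdorff_integrand \<Phi> f x y \<partial>lebesgue)"

definition radial :: "('a::euclidean_space \<Rightarrow> complex) \<Rightarrow> bool" where
  "radial \<Phi> \<longleftrightarrow> (\<forall>x y. norm x = norm y \<longrightarrow> \<Phi> x = \<Phi> y)"

(* For radial \<Phi> the choice of the point x with |x| = t is irrelevant. *)
definition radial_value :: "('a::euclidean_space \<Rightarrow> complex) \<Rightarrow> real \<Rightarrow> complex" where
  "radial_value \<Phi> t = \<Phi> (SOME x. norm x = t)"

(* The integral over (0, \<infinity>) is a lower integral when its integrand is not measurable,
   so no measurability of \<phi> is presupposed. *)
definition hausdorff_const ::
    "(real \<Rightarrow> real) \<Rightarrow> ('a::euclidean_space \<Rightarrow> complex) \<Rightarrow> ennreal" where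
  "hausdorff_const \<phi> \<Phi> =
     emeasure surface_measure (sphere (0::'a) 1) *
     (SUP r\<in>{0<..}. ennreal (1 / \<phi> r) *
        (\<integral>\<^sup>+t\<in>{0<..}. ennreal (cmod (radial_value \<Phi> t) / t * \<phi> (r / t)) \<partial>lebesgue))"

end

theory Submission
  imports Defs
begin

text \<open>
  For radial \<open>\<Phi>\<close>, polar coordinates \<open>y = \<rho>\<theta>\<close> followed by \<open>t = \<bar>x\<bar> / \<rho>\<close> give
  \<open>H\<^sub>\<Phi> f(x) = \<integral>\<^sub>0\<^sup>\<infinity> (\<Phi>(t) / t) (\<integral> f((\<bar>x\<bar> / t) \<theta>) d\<sigma>(\<theta>)) dt\<close>, a radial function of \<open>x\<close>. Jensen's inequality on the
  sphere bounds the inner integral by the angular norm of \<open>f\<close> at radius \<open>\<bar>x\<bar> / t\<close>, Minkowski's integral inequality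
  moves the radial norm inside the \<open>t\<close>-integral, and the scaling \<open>\<rho> \<mapsto> \<rho> / t\<close> turns the mean over the ball of
  radius \<open>r\<close> into the mean over the ball of radius \<open>r / t\<close>, which is at most \<open>\<phi>(r / t) \<parallel>f\<parallel>\<close>.
  As \<open>\<phi>\<close> need not be measurable, this last bound is only used pointwise in \<open>t\<close>, below a lower integral;
  all other integrands are made Borel by replacing \<open>f\<close> and the profile of \<open>\<Phi>\<close> by Borel versions.
\<close>

section \<open>Powers and integral inequalities in the extended nonnegative reals\<close>

lemma ennreal_powr_ennreal: "0 \<le> x \<Longrightarrow> ennreal_powr (ennreal x) a = ennreal (x powr a)"
  by (simp add: ennreal_powr_def)

lemma ennreal_powr_top [simp]: "ennreal_powr top a = top"
  by (simp add: ennreal_powr_def)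

lemma ennreal_powr_0 [simp]: "ennreal_powr 0 a = 0"
  by (simp add: ennreal_powr_def)

lemma ennreal_powr_1 [simp]: "ennreal_powr 1 a = 1"
  by (simp add: ennreal_powr_def)

lemma ennreal_powr_exp_1 [simp]: "ennreal_powr x 1 = x"
  by (cases x) (auto simp: ennreal_powr_ennreal)

lemma ennreal_powr_eq_0_iff [simp]: "ennreal_powr x a = 0 \<longleftrightarrow> x = 0"
  by (cases x) (auto simp: ennreal_powr_ennreal ennreal_eq_0_iff not_le)

lemma ennreal_powr_eq_top_iff [simp]: "ennreal_powr x a = top \<longleftrightarrow> x = top"
  by (cases x) (auto simp: ennreal_powr_ennreal)

lemma ennreal_powr_powr: "ennreal_powr (ennreal_powr x a) b = ennreal_powr x (a * b)"
  by (cases x) (auto simp: ennreal_powr_ennreal powr_powr)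

lemma ennreal_powr_mono:
  assumes "x \<le> y" "0 \<le> a"
  shows "ennreal_powr x a \<le> ennreal_powr y a"
  using assms by (cases x; cases y) (auto simp: ennreal_powr_ennreal top_unique intro!: ennreal_leI powr_mono2)

text \<open>No side condition on \<open>a\<close> or on the factors: if one factor is 0, both sides
  vanish because \<open>0 powr a = 0\<close> and \<open>0 * top = 0\<close>.\<close>

lemma ennreal_powr_mult: "ennreal_powr (x * y) a = ennreal_powr x a * ennreal_powr y a"
proof (cases "x = top \<or> y = top")
  case True
  then show ?thesis
    by (auto simp: ennreal_top_mult ennreal_mult_top)
next
  case False
  then show ?thesis
    by (cases x; cases y) (auto simp: ennreal_powr_ennreal powr_mult simp flip: ennreal_mult)
qed

lemma borel_measurable_ennreal_powr [measurable (raw)]: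
  assumes [measurable]: "f \<in> borel_measurable M"
  shows "(\<lambda>x. ennreal_powr (f x) a) \<in> borel_measurable M"
  unfolding ennreal_powr_def infinity_ennreal_def by measurable

section \<open>Jensen's and Minkowski's inequalities\<close>

text \<open>The tangent of the convex function \<open>u powr p\<close> at \<open>s\<close> lies
  below its graph. The constant term stands on the right so that no subtraction occurs in
  \<open>ennreal\<close>.\<close>

lemma ennreal_powr_tangent:
  assumes "1 \<le> p" "0 \<le> s"
  shows "ennreal (p * s powr (p - 1)) * u \<le> ennreal_powr u p + ennreal ((p - 1) * s powr p)"
proof (cases u)
  case (real r)
  have "p * s powr (p - 1) * r \<le> r powr p + (p - 1) * s powr p"
  proof (cases "r = 0 \<or> s = 0")
    case True
    then show ?thesis using assms by auto
  next
    case False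
    \<comment> \<open>Young's inequality for \<open>r powr p\<close> and \<open>s powr p\<close>
      with weights \<open>1/p\<close> and \<open>1 - 1/p\<close>; the second weight may be
      0.\<close>
    then have "(r powr p) powr (1/p) * (s powr p) powr (1 - 1/p) \<le> (1/p) * r powr p + (1 - 1/p) * s powr p"
      using assms real by (intro Youngs_inequality_0) auto
    moreover have "(s powr p) powr (1 - 1/p) = s powr (p - 1)"
      using assms by (simp add: powr_powr right_diff_distrib)
    moreover have "(r powr p) powr (1/p) = r"
      using assms real by (simp add: powr_powr)
    ultimately have "p * (r * s powr (p - 1)) \<le> p * ((1/p) * r powr p + (1 - 1/p) * s powr p)"
      using assms by (intro mult_left_mono) auto
    also have "\<dots> = r powr p + (p - 1) * s powr p"
      using assms by (simp add: field_simps)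
    finally show ?thesis by (simp add: ac_simps)
  qed
  with assms real show ?thesis
    by (auto simp: ennreal_powr_ennreal simp flip: ennreal_mult ennreal_plus intro!: ennreal_leI)
qed simp

text \<open>Jensen's inequality, by integrating the tangent inequality and choosing the point of
  tangency to be the integral of \<open>u\<close>. Mass at most 1 suffices because the constant term
  \<open>(p - 1) * s powr p\<close> is nonnegative.\<close>

lemma ennreal_powr_nn_integral_le:
  assumes [measurable]: "u \<in> borel_measurable M" and "1 \<le> p" and M: "emeasure M (space M) \<le> 1"
  shows "ennreal_powr (\<integral>\<^sup>+x. u x \<partial>M) p \<le> (\<integral>\<^sup>+x. ennreal_powr (u x) p \<partial>M)"
proof -
  have bound: "ennreal (p * s powr (p - 1)) * (\<integral>\<^sup>+x. u x \<partial>M)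
      \<le> (\<integral>\<^sup>+x. ennreal_powr (u x) p \<partial>M) + ennreal ((p - 1) * s powr p)" if "0 \<le> s" for s
  proof -
    have "ennreal (p * s powr (p - 1)) * (\<integral>\<^sup>+x. u x \<partial>M) = (\<integral>\<^sup>+x. ennreal (p * s powr (p - 1)) * u x \<partial>M)"
      by (simp add: nn_integral_cmult)
    also have "\<dots> \<le> (\<integral>\<^sup>+x. ennreal_powr (u x) p + ennreal ((p - 1) * s powr p) \<partial>M)"
      by (intro nn_integral_mono ennreal_powr_tangent assms that)
    also have "\<dots> = (\<integral>\<^sup>+x. ennreal_powr (u x) p \<partial>M) + ennreal ((p - 1) * s powr p) * emeasure M (space M)"
      by (simp add: nn_integral_add)
    also have "\<dots> \<le> (\<integral>\<^sup>+x. ennreal_powr (u x) p \<partial>M) + ennreal ((p - 1) * s powr p) * 1"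
      by (intro add_left_mono mult_left_mono M) auto
    finally show ?thesis by simp
  qed
  show ?thesis
  proof (cases "(\<integral>\<^sup>+x. ennreal_powr (u x) p \<partial>M)")
    case (real J)
    \<comment> \<open>The tangent at \<open>s = 1\<close> bounds \<open>p\<close> times the integral
      by a finite number, so the integral itself becomes an admissible real
      \<open>s\<close>.\<close>
    have "(\<integral>\<^sup>+x. u x \<partial>M) < top"
    proof (rule ccontr)
      assume "\<not> (\<integral>\<^sup>+x. u x \<partial>M) < top"
      then show False
        using bound[of 1] real \<open>1 \<le> p\<close>
        by (simp add: not_less top_unique ennreal_mult_top ennreal_eq_0_iff ennreal_add_eq_top)
    qed
    then obtain s where s: "(\<integral>\<^sup>+x. u x \<partial>M) = ennreal s" "0 \<le> s"
      by (cases "\<integral>\<^sup>+x. u x \<partial>M") auto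
    have "p * s powr (p - 1) * s \<le> J + (p - 1) * s powr p"
      using bound[of s] s real \<open>1 \<le> p\<close> by (simp flip: ennreal_mult ennreal_plus)
    moreover have "s powr (p - 1) * s = s powr p"
      using s by (cases "s = 0") (simp_all add: powr_diff)
    ultimately have "s powr p \<le> J"
      by (simp add: algebra_simps)
    with s real show ?thesis
      by (simp add: ennreal_powr_ennreal ennreal_leI)
  qed simp
qed

text \<open>Normalization in place of duality: with \<open>n t\<close> the norm of the slice at
  \<open>t\<close> and \<open>T\<close> the integral of \<open>n\<close>, \<open>h x t\<close> is
  \<open>T\<close> times the weight \<open>n t / T\<close> times the normalized slice
  \<open>h x t / n t\<close>. Jensen's inequality for this weight and Fubini's theorem reduce the
  claim to slices of norm 1.\<close>

lemma nn_integral_Minkowski: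
  fixes h :: "'a \<Rightarrow> 'b \<Rightarrow> ennreal"
  assumes "sigma_finite_measure M" "sigma_finite_measure N"
    and [measurable]: "case_prod h \<in> borel_measurable (M \<Otimes>\<^sub>M N)" and p: "1 \<le> p"
  shows "ennreal_powr (\<integral>\<^sup>+x. ennreal_powr (\<integral>\<^sup>+t. h x t \<partial>N) p \<partial>M) (1/p)
    \<le> (\<integral>\<^sup>+t. ennreal_powr (\<integral>\<^sup>+x. ennreal_powr (h x t) p \<partial>M) (1/p) \<partial>N)"
proof -
  interpret M: sigma_finite_measure M by fact
  interpret N: sigma_finite_measure N by fact
  interpret pair_sigma_finite M N ..
  have [measurable]: "(\<lambda>(t, x). h x t) \<in> borel_measurable (N \<Otimes>\<^sub>M M)"
    by measurable
  define n where "n t = ennreal_powr (\<integral>\<^sup>+x. ennreal_powr (h x t) p \<partial>M) (1/p)" for t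
  define T where "T = (\<integral>\<^sup>+t. n t \<partial>N)"
  have n_meas [measurable]: "n \<in> borel_measurable N"
    unfolding n_def by measurable
  show ?thesis
  proof (cases "T = top")
    case True
    then show ?thesis by (simp add: T_def n_def)
  next
    case False
    have n_fin: "AE t in N. n t \<noteq> top"
      using False unfolding T_def infinity_ennreal_def[symmetric] by (intro nn_integral_PInf_AE) auto
    \<comment> \<open>For \<open>T = 0\<close> both sides vanish almost everywhere, since
      \<open>0 / 0 = 0\<close> in \<open>ennreal\<close>.\<close>
    have n_T: "AE t in N. n t = T * (n t / T)"
    proof (cases "T = 0")
      case True
      then have "AE t in N. n t = 0"
        unfolding T_def by (subst (asm) nn_integral_0_iff_AE) auto
      then show ?thesis by eventually_elim simp
    next
      case nz: False
      with False show ?thesis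
        by (intro AE_I2) (metis ennreal_times_divide mult.commute mult_divide_eq_ennreal)
    qed
    \<comment> \<open>Where \<open>n t = 0\<close> the quotient \<open>h x t / n t\<close> cannot
      recover \<open>h x t\<close>. There the slice vanishes for almost every \<open>x\<close>, and
      exchanging the quantifiers yields this for almost every \<open>t\<close> at fixed
      \<open>x\<close>.\<close>
    have "AE t in N. AE x in M. n t = 0 \<longrightarrow> h x t = 0"
    proof (rule AE_I2)
      fix t assume [measurable]: "t \<in> space N"
      show "AE x in M. n t = 0 \<longrightarrow> h x t = 0"
        unfolding n_def by (cases "n t = 0") (auto simp: n_def nn_integral_0_iff_AE)
    qed
    then have h0: "AE x in M. AE t in N. n t = 0 \<longrightarrow> h x t = 0"
      by (subst AE_commute) auto
    have mass: "(\<integral>\<^sup>+t. n t / T \<partial>N) \<le> 1"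
    proof -
      have "(\<integral>\<^sup>+t. n t / T \<partial>N) = T / T"
        by (subst nn_integral_divide) (simp_all add: T_def)
      also have "\<dots> \<le> 1"
        using False ennreal_divide_self[of T] by (cases "T = 0") (auto simp: less_top)
      finally show ?thesis .
    qed
    \<comment> \<open>A slice with \<open>0 < n t < \<infinity>\<close> has normalized
      \<open>p\<close>-th power integral 1; if \<open>n t = 0\<close>, its weight is 0.\<close>
    have slice: "(\<integral>\<^sup>+x. ennreal_powr (h x t / n t) p \<partial>M) * (n t / T) \<le> n t / T"
      if "n t \<noteq> top" "t \<in> space N" for t
    proof (cases "n t = 0")
      case nz: False
      note \<open>t \<in> space N\<close> [measurable]
      have "(\<integral>\<^sup>+x. ennreal_powr (h x t / n t) p \<partial>M) =
          (\<integral>\<^sup>+x. ennreal_powr (h x t) p \<partial>M) * ennreal_powr (inverse (n t)) p"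
        by (simp add: divide_ennreal_def ennreal_powr_mult nn_integral_multc)
      also have "(\<integral>\<^sup>+x. ennreal_powr (h x t) p \<partial>M) = ennreal_powr (n t) p"
        using p by (simp add: n_def ennreal_powr_powr)
      also have "ennreal_powr (n t) p * ennreal_powr (inverse (n t)) p = 1"
        using nz that by (simp flip: ennreal_powr_mult divide_ennreal_def add: ennreal_divide_self less_top)
      finally show ?thesis by simp
    qed simp
    have "(\<integral>\<^sup>+x. ennreal_powr (\<integral>\<^sup>+t. h x t \<partial>N) p \<partial>M)
      \<le> (\<integral>\<^sup>+x. ennreal_powr T p * (\<integral>\<^sup>+t. ennreal_powr (h x t / n t) p * (n t / T) \<partial>N) \<partial>M)"
    proof (rule nn_integral_mono_AE, use h0 AE_space in eventually_elim)
      fix x assume *: "AE t in N. n t = 0 \<longrightarrow> h x t = 0" and [measurable]: "x \<in> space M"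
      \<comment> \<open>Jensen's inequality for \<open>h x t / n t\<close> and the weight \<open>n t / T\<close>, whose total mass is at most 1\<close>
      let ?D = "density N (\<lambda>t. n t / T)"
      have "(\<integral>\<^sup>+t. h x t \<partial>N) = (\<integral>\<^sup>+t. T * ((n t / T) * (h x t / n t)) \<partial>N)"
      proof (rule nn_integral_cong_AE, use * n_T n_fin in eventually_elim)
        fix t assume t: "n t = 0 \<longrightarrow> h x t = 0" "n t = T * (n t / T)" "n t \<noteq> top"
        have "T * ((n t / T) * (h x t / n t)) = n t * (h x t / n t)"
          using t(2) by (simp add: mult.assoc[symmetric])
        also have "\<dots> = h x t"
          using t(1,3) by (cases "n t = 0") (simp_all add: ennreal_times_divide mult.commute[of "n t"] mult_divide_eq_ennreal)
        finally show "h x t = T * ((n t / T) * (h x t / n t))" ..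
      qed
      also have "\<dots> = T * (\<integral>\<^sup>+t. h x t / n t \<partial>?D)"
        by (simp add: nn_integral_cmult nn_integral_density)
      finally have "ennreal_powr (\<integral>\<^sup>+t. h x t \<partial>N) p = ennreal_powr T p * ennreal_powr (\<integral>\<^sup>+t. h x t / n t \<partial>?D) p"
        by (simp add: ennreal_powr_mult)
      also have "\<dots> \<le> ennreal_powr T p * (\<integral>\<^sup>+t. ennreal_powr (h x t / n t) p \<partial>?D)"
      proof (intro mult_left_mono ennreal_powr_nn_integral_le p)
        have "emeasure ?D (space ?D) = (\<integral>\<^sup>+t. n t / T \<partial>N)"
          by (simp add: emeasure_density cong: nn_integral_cong)
        then show "emeasure ?D (space ?D) \<le> 1" using mass by simp
      qed simp_all
      also have "\<dots> = ennreal_powr T p * (\<integral>\<^sup>+t. ennreal_powr (h x t / n t) p * (n t / T) \<partial>N)"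
        by (simp add: nn_integral_density mult.commute)
      finally show "ennreal_powr (\<integral>\<^sup>+t. h x t \<partial>N) p
        \<le> ennreal_powr T p * (\<integral>\<^sup>+t. ennreal_powr (h x t / n t) p * (n t / T) \<partial>N)" .
    qed
    also have "\<dots> = ennreal_powr T p * (\<integral>\<^sup>+x. (\<integral>\<^sup>+t. ennreal_powr (h x t / n t) p * (n t / T) \<partial>N) \<partial>M)"
      by (simp add: nn_integral_cmult)
    also have "(\<integral>\<^sup>+x. (\<integral>\<^sup>+t. ennreal_powr (h x t / n t) p * (n t / T) \<partial>N) \<partial>M)
      = (\<integral>\<^sup>+t. (\<integral>\<^sup>+x. ennreal_powr (h x t / n t) p * (n t / T) \<partial>M) \<partial>N)"
      by (rule Fubini'[symmetric]) measurable
    also have "\<dots> = (\<integral>\<^sup>+t. (\<integral>\<^sup>+x. ennreal_powr (h x t / n t) p \<partial>M) * (n t / T) \<partial>N)"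
      by (intro nn_integral_cong nn_integral_multc) measurable
    also have "\<dots> \<le> (\<integral>\<^sup>+t. n t / T \<partial>N)"
      by (rule nn_integral_mono_AE, use n_fin AE_space in eventually_elim) (rule slice)
    also have "\<dots> \<le> 1" by (rule mass)
    finally have "(\<integral>\<^sup>+x. ennreal_powr (\<integral>\<^sup>+t. h x t \<partial>N) p \<partial>M) \<le> ennreal_powr T p"
      by (simp add: mult_left_mono)
    then have "ennreal_powr (\<integral>\<^sup>+x. ennreal_powr (\<integral>\<^sup>+t. h x t \<partial>N) p \<partial>M) (1/p) \<le> ennreal_powr (ennreal_powr T p) (1/p)"
      using p by (intro ennreal_powr_mono) auto
    then show ?thesis
      using p by (simp add: ennreal_powr_powr T_def n_def)
  qed
qed

section \<open>Polar coordinates\<close>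

text \<open>The surface measure before completion, and carried by all Borel sets of the ambient space: this keeps
  it \<open>\<sigma>\<close>-finite and makes fibre maps such as \<open>\<theta> \<mapsto> \<rho>\<theta>\<close> Borel, as Fubini's theorem needs.\<close>
definition cone_measure :: "'a::euclidean_space measure" where
  "cone_measure = distr (scale_measure (of_nat DIM('a)) (restrict_space lborel (ball 0 1 - {0}))) borel sgn"

lemma sets_cone_measure [simp, measurable_cong]: "sets cone_measure = sets borel"
  by (simp add: cone_measure_def)

lemma space_cone_measure [simp]: "space cone_measure = UNIV"
  by (simp add: cone_measure_def)

section \<open>Surface measure and cone measure\<close>

lemma sgn_measurable_punctured_ball:
  "sgn \<in> scale_measure (of_nat DIM('a)) (restrict_space lborel (ball (0::'a::euclidean_space) 1 - {0})) \<rightarrow>\<^sub>M borel"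
  by (subst measurable_cong_sets[OF sets_scale_measure refl]) (intro measurable_restrict_space1, simp)

text \<open>Both measures push the same measure forward under \<open>sgn\<close>; they differ in the
  target space and by a completion, and neither affects the integral of a Borel function.\<close>

lemma nn_integral_surface_measure:
  fixes g :: "'a::euclidean_space \<Rightarrow> ennreal"
  assumes [measurable]: "g \<in> borel_measurable borel"
  shows "(\<integral>\<^sup>+\<theta>. g \<theta> \<partial>surface_measure) = (\<integral>\<^sup>+\<theta>. g \<theta> \<partial>cone_measure)"
proof -
  have "sgn \<in> scale_measure (of_nat DIM('a)) (restrict_space lborel (ball (0::'a) 1 - {0}))
      \<rightarrow>\<^sub>M restrict_space borel (sphere (0::'a) 1)"
    by (intro measurable_restrict_space2) (auto simp: space_scale_measure space_restrict_space norm_sgn sgn_measurable_punctured_ball)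
  moreover have "g \<in> borel_measurable (restrict_space borel (sphere 0 1))"
    by (intro measurable_restrict_space1) simp
  ultimately show ?thesis
    by (simp add: sgn_measurable_punctured_ball surface_measure_def cone_measure_def nn_integral_completion nn_integral_distr)
qed

lemma space_surface_measure [simp]: "space surface_measure = sphere 0 1"
  by (simp add: surface_measure_def space_restrict_space)

lemma measurable_surface_measure:
  "g \<in> borel \<rightarrow>\<^sub>M N \<Longrightarrow> g \<in> surface_measure \<rightarrow>\<^sub>M N"
  unfolding surface_measure_def
  by (intro measurable_completion) (auto intro: measurable_restrict_space1 simp: measurable_distr_eq1)

lemma emeasure_cone_measure:
  fixes B :: "'a::euclidean_space set"
  assumes [measurable]: "B \<in> sets borel"
  shows "emeasure cone_measure B = of_nat DIM('a) * emeasure lborel {x. x \<noteq> 0 \<and> norm x < 1 \<and> sgn x \<in> B}"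
proof -
  have "sgn -` B \<inter> (ball 0 1 - {0}) = {x. x \<noteq> 0 \<and> norm x < 1 \<and> sgn x \<in> B}"
    by auto
  moreover have "emeasure (restrict_space lborel (ball 0 1 - {0})) {x. x \<noteq> 0 \<and> norm x < 1 \<and> sgn x \<in> B}
      = emeasure lborel {x. x \<noteq> 0 \<and> norm x < 1 \<and> sgn x \<in> B}"
    by (rule emeasure_restrict_space) auto
  ultimately show ?thesis
    by (simp add: sgn_measurable_punctured_ball cone_measure_def emeasure_distr space_scale_measure space_restrict_space)
qed

lemma finite_cone_measure: "finite_measure (cone_measure :: 'a::euclidean_space measure)"
proof
  have "emeasure lborel {x::'a. x \<noteq> 0 \<and> norm x < 1} \<le> emeasure lborel (ball (0::'a) 1)"
    by (intro emeasure_mono) auto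
  also have "\<dots> < \<infinity>"
    by (rule emeasure_lborel_ball_finite)
  finally have "emeasure lborel {x::'a. x \<noteq> 0 \<and> norm x < 1} \<noteq> top"
    by simp
  then show "emeasure (cone_measure :: 'a measure) (space cone_measure) \<noteq> \<infinity>"
    by (simp add: emeasure_cone_measure ennreal_mult_eq_top_iff)
qed

interpretation cone_measure: finite_measure "cone_measure :: 'a::euclidean_space measure"
  by (rule finite_cone_measure)

text \<open>Positivity permits division by the total mass in Jensen's inequality and guarantees that
  a property valid almost everywhere holds in some direction.\<close>

lemma emeasure_cone_measure_UNIV_pos: "0 < emeasure (cone_measure :: 'a::euclidean_space measure) UNIV"
proof -
  have "emeasure lborel (ball (0::'a) 1) = emeasure lborel (ball (0::'a) 1 - {0})"
    by (rule emeasure_Diff_null_set[symmetric]) auto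
  also have "ball (0::'a) 1 - {0} = {x. x \<noteq> 0 \<and> norm x < 1 \<and> sgn x \<in> UNIV}"
    by auto
  finally have "emeasure lborel {x::'a. x \<noteq> 0 \<and> norm x < 1 \<and> sgn x \<in> UNIV} \<noteq> 0"
    using content_ball_pos[of 1 "0::'a"] by (auto simp: measure_def)
  then show ?thesis
    by (simp add: emeasure_cone_measure zero_less_iff_neq_zero)
qed

lemma emeasure_surface_measure_sphere:
  "emeasure surface_measure (sphere (0::'a::euclidean_space) 1) = emeasure (cone_measure :: 'a measure) UNIV"
proof -
  have "emeasure surface_measure (space (surface_measure :: 'a measure)) = nn_integral surface_measure (\<lambda>_::'a. 1)"
    by (simp only: nn_integral_const mult_1)
  also have "\<dots> = emeasure (cone_measure :: 'a measure) UNIV"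
    by (subst nn_integral_surface_measure) auto
  finally show ?thesis by simp
qed

section \<open>Decomposition of Lebesgue measure into radius and direction\<close>

lemma nn_integral_lborel_scaleR:
  fixes g :: "'a::euclidean_space \<Rightarrow> ennreal"
  assumes [measurable]: "g \<in> borel_measurable borel" and "0 < c"
  shows "(\<integral>\<^sup>+x. g x \<partial>lborel) = ennreal (c ^ DIM('a)) * (\<integral>\<^sup>+x. g (c *\<^sub>R x) \<partial>lborel)"
  using assms by (subst lborel_affine[of c 0]) (simp_all add: nn_integral_density nn_integral_distr nn_integral_cmult)

lemma emeasure_lborel_cone:
  fixes B :: "'a::euclidean_space set"
  assumes [measurable]: "B \<in> sets borel" and "0 < b"
  shows "emeasure lborel {x. x \<noteq> 0 \<and> norm x < b \<and> sgn x \<in> B}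
    = ennreal (b ^ DIM('a)) * emeasure lborel {x. x \<noteq> 0 \<and> norm x < 1 \<and> sgn x \<in> B}"
proof -
  have "emeasure lborel {x. x \<noteq> 0 \<and> norm x < b \<and> sgn x \<in> B}
      = (\<integral>\<^sup>+x. indicator {x. x \<noteq> 0 \<and> norm x < b \<and> sgn x \<in> B} x \<partial>lborel)"
    by simp
  also have "\<dots> = ennreal (b ^ DIM('a)) *
      (\<integral>\<^sup>+x. indicator {x. x \<noteq> 0 \<and> norm x < b \<and> sgn x \<in> B} (b *\<^sub>R x) \<partial>lborel)"
    using \<open>0 < b\<close> by (intro nn_integral_lborel_scaleR) auto
  also have "(\<lambda>x. indicator {x. x \<noteq> 0 \<and> norm x < b \<and> sgn x \<in> B} (b *\<^sub>R x) :: ennreal)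
      = indicator {x. x \<noteq> 0 \<and> norm x < 1 \<and> sgn x \<in> B}"
    using \<open>0 < b\<close> by (auto simp: fun_eq_iff indicator_def sgn_scaleR)
  finally show ?thesis
    by simp
qed

lemma nn_integral_power_lessThan:
  assumes "0 < (b::real)" "0 < n"
  shows "(\<integral>\<^sup>+\<rho>\<in>{0<..<b}. ennreal (\<rho> ^ (n - 1)) \<partial>lborel) = ennreal (b ^ n / n)"
proof -
  have "(\<integral>\<^sup>+\<rho>\<in>{0<..<b}. ennreal (\<rho> ^ (n - 1)) \<partial>lborel) = (\<integral>\<^sup>+\<rho>\<in>{0..b}. ennreal (\<rho> ^ (n - 1)) \<partial>lborel)"
    by (rule nn_integral_cong_AE, use AE_lborel_singleton[of 0] AE_lborel_singleton[of b] in eventually_elim)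
       (auto simp: indicator_def)
  also have "\<dots> = ennreal (b ^ n / n - 0 ^ n / n)"
  proof (intro nn_integral_FTC_Icc)
    fix x :: real
    show "((\<lambda>x. x ^ n / real n) has_real_derivative x ^ (n - 1)) (at x)"
      using DERIV_cdivide[OF DERIV_pow[of n x], of "real n"] assms by simp
  qed (use assms in auto)
  finally show ?thesis using assms by (simp add: zero_power)
qed

text \<open>Polar coordinates for rectangles. For fixed \<open>B\<close> both sides are measures in
  \<open>A\<close>, and they agree on the rays \<open>{..<b}\<close>: the radial integral
  \<open>b ^ n / n\<close> cancels the factor \<open>n\<close> in the cone measure, leaving the
  volume of the cone scaled by \<open>b\<close>.\<close>

lemma cone_measure_times_radial:
  fixes B :: "'a::euclidean_space set" and A :: "real set"
  assumes [measurable]: "B \<in> sets borel" "A \<in> sets borel"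
  shows "(\<integral>\<^sup>+\<rho>\<in>{0<..}. indicator A \<rho> * ennreal (\<rho> ^ (DIM('a) - 1)) \<partial>lborel) * emeasure cone_measure B
    = emeasure lborel {x. x \<noteq> 0 \<and> norm x \<in> A \<and> sgn x \<in> B}"
proof -
  let ?L = "distr (density lborel (indicator {x. x \<noteq> 0 \<and> sgn x \<in> B})) borel norm"
  let ?R = "scale_measure (emeasure cone_measure B)
    (density lborel (\<lambda>\<rho>. ennreal (\<rho> ^ (DIM('a) - 1)) * indicator {0<..} \<rho>))"
  have L: "emeasure ?L X = emeasure lborel {x. x \<noteq> 0 \<and> norm x \<in> X \<and> sgn x \<in> B}"
    if [measurable]: "X \<in> sets borel" for X :: "real set"
  proof -
    have [measurable]: "norm -` X \<in> sets (borel :: 'a measure)"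
      using measurable_sets[OF _ that, of norm borel] by simp
    have "emeasure ?L X = (\<integral>\<^sup>+x. indicator {x. x \<noteq> 0 \<and> sgn x \<in> B} x * indicator (norm -` X) x \<partial>lborel)"
      by (subst emeasure_distr) (auto simp: emeasure_density)
    also have "\<dots> = (\<integral>\<^sup>+x. indicator {x. x \<noteq> 0 \<and> norm x \<in> X \<and> sgn x \<in> B} x \<partial>lborel)"
      by (intro nn_integral_cong) (auto simp: indicator_def)
    finally show ?thesis by simp
  qed
  have R: "emeasure ?R X = (\<integral>\<^sup>+\<rho>\<in>{0<..}. indicator X \<rho> * ennreal (\<rho> ^ (DIM('a) - 1)) \<partial>lborel) * emeasure cone_measure B"
    if [measurable]: "X \<in> sets borel" for X :: "real set"
    by (simp add: emeasure_density ac_simps)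
  have eq: "emeasure ?L {..<b} = emeasure ?R {..<b}" for b
  proof (cases "0 < b")
    case True
    have "(\<integral>\<^sup>+\<rho>\<in>{0<..}. indicator {..<b} \<rho> * ennreal (\<rho> ^ (DIM('a) - 1)) \<partial>lborel)
      = (\<integral>\<^sup>+\<rho>\<in>{0<..<b}. ennreal (\<rho> ^ (DIM('a) - 1)) \<partial>lborel)"
      by (intro nn_integral_cong) (auto simp: indicator_def)
    also have "\<dots> = ennreal (b ^ DIM('a) / DIM('a))"
      using True by (intro nn_integral_power_lessThan) auto
    finally have "emeasure ?R {..<b} = ennreal (b ^ DIM('a) / DIM('a)) * emeasure cone_measure B"
      by (simp only: R[OF lessThan_borel])
    also have "\<dots> = (ennreal (b ^ DIM('a) / DIM('a)) * of_nat DIM('a)) *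
        emeasure lborel {x. x \<noteq> 0 \<and> norm x < 1 \<and> sgn x \<in> B}"
      by (simp add: emeasure_cone_measure ac_simps)
    also have "ennreal (b ^ DIM('a) / DIM('a)) * of_nat DIM('a) = ennreal (b ^ DIM('a))"
      using True by (simp add: ennreal_of_nat_eq_real_of_nat flip: ennreal_mult)
    finally show ?thesis
      using True emeasure_lborel_cone[of B b] by (simp add: L)
  next
    case False
    have "{x. x \<noteq> 0 \<and> norm x \<in> {..<b} \<and> sgn x \<in> B} = {}"
      using False by (auto dest: le_less_trans[OF norm_ge_zero])
    moreover have "(\<integral>\<^sup>+\<rho>\<in>{0<..}. indicator {..<b} \<rho> * ennreal (\<rho> ^ (DIM('a) - 1)) \<partial>lborel) = nn_integral lborel (\<lambda>_::real. 0)"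
      using False by (intro nn_integral_cong) (auto simp: indicator_def)
    ultimately show ?thesis
      by (simp only: L[OF lessThan_borel] R[OF lessThan_borel]) simp
  qed
  \<comment> \<open>The rays are stable under intersection and generate the Borel sets; finiteness
    along the exhausting sequence holds because the truncated cone lies in a ball.\<close>
  have "?L = ?R"
  proof (rule measure_eqI_generator_eq[where E="range lessThan" and \<Omega>=UNIV and A="\<lambda>i. {..<real i}"])
    show "Int_stable (range (lessThan :: real \<Rightarrow> _))"
    proof (rule Int_stableI_image)
      show "\<exists>k\<in>UNIV. {..<i} \<inter> {..<j} = {..<k}" for i j :: real
        by (intro bexI[of _ "min i j"]) auto
    qed
    have "borel = sigma UNIV (range (lessThan :: real \<Rightarrow> _))"
      using borel_eq_lessThan[where 'a=real] by (simp add: eucl_lessThan)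
    then have "sets borel = sigma_sets UNIV (range (lessThan :: real \<Rightarrow> _))"
      by (metis sets_measure_of top_greatest Pow_UNIV)
    then show "sets ?L = sigma_sets UNIV (range lessThan)" "sets ?R = sigma_sets UNIV (range lessThan)"
      by simp_all
    show "(\<Union>i. {..<real i}) = UNIV"
      using reals_Archimedean2 by auto
    show "emeasure ?L {..<real i} \<noteq> \<infinity>" for i
    proof -
      have "emeasure ?L {..<real i} \<le> emeasure lborel (ball (0::'a) (real i))"
        unfolding L[OF lessThan_borel] by (intro emeasure_mono) auto
      also have "\<dots> < \<infinity>"
        by (rule emeasure_lborel_ball_finite)
      finally show ?thesis by simp
    qed
  qed (use eq in auto)
  then show ?thesis
    using L[of A] R[of A] assms by simp
qed

text \<open>The map from \<open>x\<close> to \<open>(norm x, sgn x)\<close> carries Lebesgue measure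
  off the origin to the product of the weighted radial measure and the cone measure. Agreement on
  rectangles identifies the two by \<sigma>-finiteness, and Fubini's theorem gives the iterated
  integral.\<close>

lemma nn_integral_polar:
  fixes g :: "'a::euclidean_space \<Rightarrow> ennreal"
  assumes [measurable]: "g \<in> borel_measurable borel"
  shows "(\<integral>\<^sup>+x. g x \<partial>lborel)
    = (\<integral>\<^sup>+\<rho>\<in>{0<..}. (\<integral>\<^sup>+\<theta>. g (\<rho> *\<^sub>R \<theta>) \<partial>cone_measure) * ennreal (\<rho> ^ (DIM('a) - 1)) \<partial>lborel)"
proof -
  let ?M = "density lborel (\<lambda>\<rho>. ennreal (\<rho> ^ (DIM('a) - 1)) * indicator {0<..} \<rho>)"
  let ?D = "density lborel (indicator (- {0::'a}))"
  have fin: "sigma_finite_measure ?M"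
    by (subst sigma_finite_measure.sigma_finite_iff_density_finite[OF sigma_finite_lborel]) (auto simp: ennreal_mult_eq_top_iff indicator_def)
  have M: "emeasure ?M A = (\<integral>\<^sup>+\<rho>\<in>{0<..}. indicator A \<rho> * ennreal (\<rho> ^ (DIM('a) - 1)) \<partial>lborel)"
    if [measurable]: "A \<in> sets borel" for A
    by (simp add: emeasure_density ac_simps)
  have pair: "?M \<Otimes>\<^sub>M cone_measure = distr ?D (borel \<Otimes>\<^sub>M borel) (\<lambda>x. (norm x, sgn x))"
  proof (rule pair_measure_eqI[OF fin cone_measure.sigma_finite_measure_axioms])
    show "sets (?M \<Otimes>\<^sub>M cone_measure) = sets (distr ?D (borel \<Otimes>\<^sub>M borel) (\<lambda>x. (norm x, sgn x)))"
      by (simp cong: sets_pair_measure_cong)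
    fix A B assume "A \<in> sets ?M" "B \<in> sets (cone_measure :: 'a measure)"
    then have [measurable]: "A \<in> sets borel" "B \<in> sets borel" by auto
    have "(\<lambda>x::'a. (norm x, sgn x)) -` (A \<times> B) = {x. norm x \<in> A \<and> sgn x \<in> B}"
      by auto
    then have [measurable]: "(\<lambda>x::'a. (norm x, sgn x)) -` (A \<times> B) \<in> sets borel"
      by simp
    have "emeasure (distr ?D (borel \<Otimes>\<^sub>M borel) (\<lambda>x. (norm x, sgn x))) (A \<times> B)
      = (\<integral>\<^sup>+x. indicator (- {0}) x * indicator ((\<lambda>x. (norm x, sgn x)) -` (A \<times> B)) x \<partial>lborel)"
      by (subst emeasure_distr) (auto simp: emeasure_density)
    also have "\<dots> = (\<integral>\<^sup>+x. indicator {x. x \<noteq> 0 \<and> norm x \<in> A \<and> sgn x \<in> B} x \<partial>lborel)"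
      by (intro nn_integral_cong) (auto simp: indicator_def)
    finally show "emeasure ?M A * emeasure cone_measure B =
        emeasure (distr ?D (borel \<Otimes>\<^sub>M borel) (\<lambda>x. (norm x, sgn x))) (A \<times> B)"
      by (simp only: M[OF \<open>A \<in> sets borel\<close>] cone_measure_times_radial[OF \<open>B \<in> sets borel\<close> \<open>A \<in> sets borel\<close>]) simp
  qed
  have "(\<integral>\<^sup>+x. g x \<partial>lborel) = (\<integral>\<^sup>+x. indicator (- {0}) x * g (norm x *\<^sub>R sgn x) \<partial>lborel)"
    by (rule nn_integral_cong_AE, use AE_lborel_singleton[of 0] in eventually_elim) (simp add: sgn_div_norm)
  also have "\<dots> = (\<integral>\<^sup>+z. g (fst z *\<^sub>R snd z) \<partial>distr ?D (borel \<Otimes>\<^sub>M borel) (\<lambda>x. (norm x, sgn x)))"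
    by (simp add: nn_integral_distr nn_integral_density)
  also have "\<dots> = (\<integral>\<^sup>+\<rho>. (\<integral>\<^sup>+\<theta>. g (\<rho> *\<^sub>R \<theta>) \<partial>cone_measure) \<partial>?M)"
    unfolding pair[symmetric] by (subst cone_measure.nn_integral_fst[symmetric]) simp_all
  also have "\<dots> = (\<integral>\<^sup>+\<rho>\<in>{0<..}. (\<integral>\<^sup>+\<theta>. g (\<rho> *\<^sub>R \<theta>) \<partial>cone_measure) * ennreal (\<rho> ^ (DIM('a) - 1)) \<partial>lborel)"
    by (simp add: nn_integral_density ac_simps)
  finally show ?thesis .
qed

section \<open>Inversion of the multiplicative Haar measure\<close>

text \<open>The substitution \<open>s = exp u\<close> turns \<open>ds / s\<close> into
  \<open>du\<close>. It is made on the compact intervals \<open>?J k\<close> with images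
  \<open>?I k\<close>, and monotone convergence exhausts the line and the half-line.\<close>

lemma nn_integral_exp_substitution:
  fixes F :: "real \<Rightarrow> ennreal"
  assumes [measurable]: "F \<in> borel_measurable borel"
  shows "(\<integral>\<^sup>+s\<in>{0<..}. F s * ennreal (1 / s) \<partial>lborel) = (\<integral>\<^sup>+u. F (exp u) \<partial>lborel)"
proof -
  let ?I = "\<lambda>k::nat. {exp (- real k)..exp (real k)}"
  let ?J = "\<lambda>k::nat. {- real k..real k}"
  have "(\<integral>\<^sup>+s. F s * ennreal (1 / s) * indicator (?I k) s \<partial>lborel)
      = (\<integral>\<^sup>+u. F (exp u) * indicator (?J k) u \<partial>lborel)" for k
  proof (cases "k = 0")
    \<comment> \<open>For \<open>k = 0\<close> both intervals are single points, hence null, and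
      fall outside the substitution rule for proper intervals.\<close>
    case True
    have "AE s in lborel. s \<noteq> (1::real)" "AE s in lborel. s \<noteq> (0::real)"
      by (rule AE_lborel_singleton)+
    then have "(\<integral>\<^sup>+s. F s * ennreal (1 / s) * indicator {1} s \<partial>lborel) = nn_integral lborel (\<lambda>_::real. 0)"
      "(\<integral>\<^sup>+s. F (exp s) * indicator {0} s \<partial>lborel) = nn_integral lborel (\<lambda>_::real. 0)"
      by (intro nn_integral_cong_AE; eventually_elim; simp)+
    with True show ?thesis by simp
  next
    case False
    then have "(\<integral>\<^sup>+s. F s * ennreal (1 / s) * indicator (?I k) s \<partial>lborel)
        = (\<integral>\<^sup>+u. F (exp u) * ennreal (1 / exp u) * ennreal (exp u) * indicator (?J k) u \<partial>lborel)"
      by (intro nn_integral_substitution_aux) (auto intro!: derivative_eq_intros continuous_intros)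
    also have "\<dots> = (\<integral>\<^sup>+u. F (exp u) * indicator (?J k) u \<partial>lborel)"
      by (intro nn_integral_cong) (simp add: mult.assoc flip: ennreal_mult)
    finally show ?thesis .
  qed
  then have steps: "(SUP k. \<integral>\<^sup>+s. F s * ennreal (1 / s) * indicator (?I k) s \<partial>lborel)
      = (SUP k. \<integral>\<^sup>+u. F (exp u) * indicator (?J k) u \<partial>lborel)"
    by simp
  have "exp (- real (Suc k)) \<le> exp (- real k)" "exp (real k) \<le> exp (real (Suc k))" for k
    by simp_all
  then have sub: "?I k \<subseteq> ?I (Suc k)" for k
    by (meson atLeastatMost_subset_iff)
  have "indicator (?I k) s \<le> (indicator (?I (Suc k)) s :: ennreal)" for k s
    using sub[of k] by (cases "s \<in> ?I k") (simp_all add: subset_iff del: atLeastAtMost_iff of_nat_Suc)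
  then have "incseq (\<lambda>k s. F s * ennreal (1 / s) * indicator (?I k) s)"
    by (intro incseq_SucI le_funI mult_left_mono) auto
  then have supI: "(\<integral>\<^sup>+s. (SUP k. F s * ennreal (1 / s) * indicator (?I k) s) \<partial>lborel)
      = (SUP k. \<integral>\<^sup>+s. F s * ennreal (1 / s) * indicator (?I k) s \<partial>lborel)"
    by (rule nn_integral_monotone_convergence_SUP) measurable
  have "incseq (\<lambda>k u. F (exp u) * indicator (?J k) u)"
    by (auto simp: incseq_def le_fun_def indicator_def)
  then have supJ: "(\<integral>\<^sup>+u. (SUP k. F (exp u) * indicator (?J k) u) \<partial>lborel)
      = (SUP k. \<integral>\<^sup>+u. F (exp u) * indicator (?J k) u \<partial>lborel)"
    by (rule nn_integral_monotone_convergence_SUP) measurable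
  have sup: "(SUP k. c * indicator (?J k) u) = c" for c :: ennreal and u
  proof (rule antisym)
    obtain k :: nat where "\<bar>u\<bar> \<le> real k" using real_arch_simple by blast
    then have "c \<le> c * indicator (?J k) u" by (simp add: abs_le_iff indicator_def)
    then show "c \<le> (SUP k. c * indicator (?J k) u)" by (rule SUP_upper2[OF UNIV_I])
  qed (auto intro!: SUP_least simp: indicator_def)
  have "(SUP k. F s * ennreal (1 / s) * indicator (?I k) s) = F s * ennreal (1 / s) * indicator {0<..} s" for s
  proof (cases "0 < s")
    case True
    then have "indicator (?I k) s = (indicator (?J k) (ln s) :: ennreal)" for k
      using exp_le_cancel_iff[of "- real k" "ln s"] exp_le_cancel_iff[of "ln s" "real k"]
      by (simp add: indicator_def del: exp_le_cancel_iff)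
    with True sup[of "F s * ennreal (1 / s)" "ln s"] show ?thesis by simp
  next
    case False
    then have "\<not> exp (- real k) \<le> s" for k
      by (meson exp_gt_zero order.strict_trans2)
    with False show ?thesis by simp
  qed
  then have "(\<integral>\<^sup>+s\<in>{0<..}. F s * ennreal (1 / s) \<partial>lborel) =
      (SUP k. \<integral>\<^sup>+u. F (exp u) * indicator (?J k) u \<partial>lborel)"
    by (simp only: flip: steps supI)
  then show ?thesis
    by (simp only: flip: supJ) (simp only: sup)
qed

text \<open>In the logarithmic coordinate the map from \<open>s\<close> to \<open>c / s\<close> is
  the reflection of \<open>u\<close> to \<open>ln c - u\<close>, which preserves Lebesgue
  measure.\<close>

lemma nn_integral_inverse:
  fixes F :: "real \<Rightarrow> ennreal"
  assumes [measurable]: "F \<in> borel_measurable borel" and "0 < c"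
  shows "(\<integral>\<^sup>+s\<in>{0<..}. F (c / s) * ennreal (1 / s) \<partial>lborel) = (\<integral>\<^sup>+t\<in>{0<..}. F t * ennreal (1 / t) \<partial>lborel)"
proof -
  have "(\<integral>\<^sup>+s\<in>{0<..}. F (c / s) * ennreal (1 / s) \<partial>lborel) = (\<integral>\<^sup>+u. F (c / exp u) \<partial>lborel)"
    by (rule nn_integral_exp_substitution[where F="\<lambda>s. F (c / s)"]) simp
  also have "\<dots> = (\<integral>\<^sup>+u. F (exp (ln c + (-1) * u)) \<partial>lborel)"
    using \<open>0 < c\<close> by (simp add: exp_diff)
  also have "\<dots> = (\<integral>\<^sup>+u. F (exp u) \<partial>lborel)"
    by (subst nn_integral_real_affine[where c="-1" and t="ln c" and f="\<lambda>u. F (exp u)"]) auto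
  finally show ?thesis
    by (simp add: nn_integral_exp_substitution)
qed

section \<open>Null sets and Borel versions in polar coordinates\<close>

lemma cone_measure_AE_norm: "AE \<theta> in cone_measure. norm (\<theta> :: 'a::euclidean_space) = 1"
proof (rule AE_I)
  have "{x::'a. x \<noteq> 0 \<and> norm x < 1 \<and> sgn x \<in> {\<theta>. norm \<theta> \<noteq> 1}} = {}"
    by (auto simp: norm_sgn)
  then show "emeasure cone_measure {\<theta>::'a. norm \<theta> \<noteq> 1} = 0"
    by (subst emeasure_cone_measure) (simp_all only: emeasure_empty mult_zero_right, measurable)
qed auto

text \<open>The integral of the indicator of a Borel null set containing all exceptions is 0, so its
  polar form has null angular fibres for almost every radius. The second claim exchanges the roles
  of radius and direction by Fubini's theorem and selects one good ray.\<close>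

lemma AE_polar:
  assumes "AE x in lborel. P (x :: 'a::euclidean_space)"
  shows "AE \<rho> in lborel. 0 < \<rho> \<longrightarrow> (AE \<theta> in surface_measure. P (\<rho> *\<^sub>R \<theta>))"
    and "\<exists>\<theta>. norm \<theta> = 1 \<and> (AE \<rho> in lborel. 0 < \<rho> \<longrightarrow> P (\<rho> *\<^sub>R \<theta>))"
proof -
  obtain N where N: "{x. \<not> P x} \<subseteq> N" "emeasure lborel N = 0" "N \<in> sets borel"
    using AE_E[OF assms] by auto
  note \<open>N \<in> sets borel\<close> [measurable]
  have "(\<integral>\<^sup>+\<rho>\<in>{0<..}. (\<integral>\<^sup>+\<theta>. indicator N (\<rho> *\<^sub>R \<theta>) \<partial>cone_measure) * ennreal (\<rho> ^ (DIM('a) - 1)) \<partial>lborel) = 0"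
    using N by (subst nn_integral_polar[symmetric]) auto
  then have "AE \<rho> in lborel. (\<integral>\<^sup>+\<theta>. indicator N (\<rho> *\<^sub>R \<theta>) \<partial>cone_measure) * ennreal (\<rho> ^ (DIM('a) - 1)) * indicator {0<..} \<rho> = 0"
    by (subst (asm) nn_integral_0_iff_AE) auto
  then have fibre: "AE \<rho> in lborel. 0 < \<rho> \<longrightarrow> (\<integral>\<^sup>+\<theta>. indicator N (\<rho> *\<^sub>R \<theta>) \<partial>cone_measure) = 0"
  proof eventually_elim
    fix \<rho> :: real
    assume *: "(\<integral>\<^sup>+\<theta>. indicator N (\<rho> *\<^sub>R \<theta>) \<partial>cone_measure) * ennreal (\<rho> ^ (DIM('a) - 1)) * indicator {0<..} \<rho> = 0"
    show "0 < \<rho> \<longrightarrow> (\<integral>\<^sup>+\<theta>. indicator N (\<rho> *\<^sub>R \<theta>) \<partial>cone_measure) = 0"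
    proof
      assume "0 < \<rho>"
      then have "ennreal (\<rho> ^ (DIM('a) - 1)) * indicator {0<..} \<rho> \<noteq> 0"
        by (simp add: ennreal_eq_0_iff not_le)
      with * show "(\<integral>\<^sup>+\<theta>. indicator N (\<rho> *\<^sub>R \<theta>) \<partial>cone_measure) = 0"
        unfolding mult.assoc by (simp only: mult_eq_0_iff) simp
    qed
  qed
  have AE_N: "AE \<rho> in lborel. AE \<theta> in cone_measure. 0 < \<rho> \<longrightarrow> \<rho> *\<^sub>R \<theta> \<notin> N"
    using fibre
  proof eventually_elim
    fix \<rho> assume *: "0 < \<rho> \<longrightarrow> (\<integral>\<^sup>+\<theta>. indicator N (\<rho> *\<^sub>R \<theta>) \<partial>cone_measure) = 0"
    show "AE \<theta> in cone_measure. 0 < \<rho> \<longrightarrow> \<rho> *\<^sub>R \<theta> \<notin> N"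
    proof (cases "0 < \<rho>")
      case True
      with * have "AE \<theta> in cone_measure. indicator N (\<rho> *\<^sub>R \<theta>) = (0::ennreal)"
        by (subst (asm) nn_integral_0_iff_AE) auto
      then show ?thesis by eventually_elim (auto simp: indicator_def)
    qed simp
  qed
  show "AE \<rho> in lborel. 0 < \<rho> \<longrightarrow> (AE \<theta> in surface_measure. P (\<rho> *\<^sub>R \<theta>))"
    using fibre
  proof eventually_elim
    fix \<rho> assume *: "0 < \<rho> \<longrightarrow> (\<integral>\<^sup>+\<theta>. indicator N (\<rho> *\<^sub>R \<theta>) \<partial>cone_measure) = 0"
    show "0 < \<rho> \<longrightarrow> (AE \<theta> in surface_measure. P (\<rho> *\<^sub>R \<theta>))"
    proof
      assume "0 < \<rho>"
      have [measurable]: "(\<lambda>\<theta>. indicator N (\<rho> *\<^sub>R \<theta>) :: ennreal) \<in> borel_measurable surface_measure"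
        by (rule measurable_surface_measure) simp
      have "(\<integral>\<^sup>+\<theta>. indicator N (\<rho> *\<^sub>R \<theta>) \<partial>surface_measure) = 0"
        using * \<open>0 < \<rho>\<close> by (subst nn_integral_surface_measure) auto
      then have "AE \<theta> in surface_measure. indicator N (\<rho> *\<^sub>R \<theta>) = (0::ennreal)"
        by (subst (asm) nn_integral_0_iff_AE) auto
      then show "AE \<theta> in surface_measure. P (\<rho> *\<^sub>R \<theta>)"
        by eventually_elim (use N in \<open>auto simp: indicator_def split: if_splits\<close>)
    qed
  qed
  interpret pair_sigma_finite lborel "cone_measure :: 'a measure" ..
  have "Measurable.pred (lborel \<Otimes>\<^sub>M cone_measure) (\<lambda>z. 0 < fst z \<longrightarrow> fst z *\<^sub>R snd z \<notin> N)"
    by measurable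
  then have "AE \<theta> in cone_measure. AE \<rho> in lborel. 0 < \<rho> \<longrightarrow> \<rho> *\<^sub>R \<theta> \<notin> N"
    using AE_N by (subst AE_commute[symmetric]) (simp_all add: pred_def)
  with cone_measure_AE_norm
  have AE_ex: "AE \<theta> in cone_measure. norm \<theta> = 1 \<and> (AE \<rho> in lborel. 0 < \<rho> \<longrightarrow> \<rho> *\<^sub>R \<theta> \<notin> N)"
    by eventually_elim simp
  \<comment> \<open>If no such direction existed, the whole space would be null for the cone
    measure, against its positive mass.\<close>
  have "\<exists>\<theta>. norm \<theta> = 1 \<and> (AE \<rho> in lborel. 0 < \<rho> \<longrightarrow> \<rho> *\<^sub>R \<theta> \<notin> N)"
  proof (rule ccontr)
    assume "\<not> ?thesis"
    then have "AE \<theta> in (cone_measure :: 'a measure). False"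
      by (intro eventually_mono[OF AE_ex]) blast
    then have "UNIV \<in> null_sets (cone_measure :: 'a measure)"
      by (subst (asm) AE_iff_null) simp_all
    then show False
      using emeasure_cone_measure_UNIV_pos[where 'a='a] by (simp add: null_sets_def)
  qed
  then obtain \<theta> where \<theta>: "norm \<theta> = 1" "AE \<rho> in lborel. 0 < \<rho> \<longrightarrow> \<rho> *\<^sub>R \<theta> \<notin> N"
    by blast
  from \<theta>(2) have "AE \<rho> in lborel. 0 < \<rho> \<longrightarrow> P (\<rho> *\<^sub>R \<theta>)"
    by eventually_elim (use N in blast)
  with \<theta>(1) show "\<exists>\<theta>. norm \<theta> = 1 \<and> (AE \<rho> in lborel. 0 < \<rho> \<longrightarrow> P (\<rho> *\<^sub>R \<theta>))"
    by blast
qed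

lemma nn_integral_polar_radial:
  fixes g :: "'a::euclidean_space \<Rightarrow> ennreal"
  assumes [measurable]: "k \<in> borel_measurable borel" "g \<in> borel_measurable borel"
  shows "(\<integral>\<^sup>+x. k (norm x) * g x \<partial>lborel)
    = (\<integral>\<^sup>+\<rho>\<in>{0<..}. k \<rho> * (\<integral>\<^sup>+\<theta>. g (\<rho> *\<^sub>R \<theta>) \<partial>cone_measure) * ennreal (\<rho> ^ (DIM('a) - 1)) \<partial>lborel)"
proof -
  have "(\<integral>\<^sup>+\<theta>. k (norm (\<rho> *\<^sub>R \<theta>)) * g (\<rho> *\<^sub>R \<theta>) \<partial>cone_measure) = k \<rho> * (\<integral>\<^sup>+\<theta>. g (\<rho> *\<^sub>R \<theta>) \<partial>cone_measure)"
    if "0 < \<rho>" for \<rho>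
  proof -
    have "(\<integral>\<^sup>+\<theta>. k (norm (\<rho> *\<^sub>R \<theta>)) * g (\<rho> *\<^sub>R \<theta>) \<partial>cone_measure) = (\<integral>\<^sup>+\<theta>. k \<rho> * g (\<rho> *\<^sub>R \<theta>) \<partial>cone_measure)"
      by (rule nn_integral_cong_AE, use cone_measure_AE_norm in eventually_elim) (use that in simp)
    then show ?thesis by (simp add: nn_integral_cmult)
  qed
  then have "(\<integral>\<^sup>+\<theta>. k (norm (\<rho> *\<^sub>R \<theta>)) * g (\<rho> *\<^sub>R \<theta>) \<partial>cone_measure) * ennreal (\<rho> ^ (DIM('a) - 1)) * indicator {0<..} \<rho>
      = k \<rho> * (\<integral>\<^sup>+\<theta>. g (\<rho> *\<^sub>R \<theta>) \<partial>cone_measure) * ennreal (\<rho> ^ (DIM('a) - 1)) * indicator {0<..} \<rho>" for \<rho>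
    by (cases "0 < \<rho>") (simp_all only: greaterThan_iff indicator_simps mult_zero_right not_False_eq_True)
  then show ?thesis
    by (subst nn_integral_polar) simp_all
qed

text \<open>A null set of radii has a null preimage under the norm, since its polar integral
  vanishes. This carries exceptional sets on the half-line over to points of the space.\<close>

lemma AE_norm:
  assumes "AE \<rho> in lborel. 0 < \<rho> \<longrightarrow> P \<rho>"
  shows "AE x in lborel. x \<noteq> (0::'a::euclidean_space) \<longrightarrow> P (norm x)"
proof -
  obtain N where N: "{\<rho>. \<not> (0 < \<rho> \<longrightarrow> P \<rho>)} \<subseteq> N" "emeasure lborel N = 0" "N \<in> sets borel"
    using AE_E[OF assms] by auto
  note \<open>N \<in> sets borel\<close> [measurable]
  have "AE \<rho> in lborel. \<rho> \<notin> N"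
    using N by (intro AE_not_in) auto
  then have "AE \<rho> in lborel. indicator N \<rho> * (nn_integral cone_measure (\<lambda>_::'a. 1)) * ennreal (\<rho> ^ (DIM('a) - 1)) * indicator {0<..} \<rho> = 0"
    by eventually_elim simp
  then have "(\<integral>\<^sup>+\<rho>\<in>{0<..}. indicator N \<rho> * (nn_integral cone_measure (\<lambda>_::'a. 1)) * ennreal (\<rho> ^ (DIM('a) - 1)) \<partial>lborel) = 0"
    by (subst nn_integral_0_iff_AE) simp_all
  then have "(nn_integral lborel (\<lambda>x::'a. indicator N (norm x) * 1)) = 0"
    by (subst nn_integral_polar_radial) auto
  then have "AE x::'a in lborel. indicator N (norm x) * 1 = (0::ennreal)"
    by (subst (asm) nn_integral_0_iff_AE) auto
  then show ?thesis
  proof eventually_elim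
    fix x :: 'a assume "indicator N (norm x) * 1 = (0::ennreal)"
    then have "norm x \<notin> N" by (auto simp: indicator_def)
    then show "x \<noteq> 0 \<longrightarrow> P (norm x)"
      using N(1) zero_less_norm_iff[of x] by blast
  qed
qed

text \<open>On the half-line \<open>dt\<close> and \<open>dt / t\<close> have the same null sets,
  and the latter measure is invariant under inversion.\<close>

lemma AE_inverse:
  assumes "AE t in lborel. 0 < t \<longrightarrow> P t" and "0 < (c::real)"
  shows "AE \<rho> in lborel. 0 < \<rho> \<longrightarrow> P (c / \<rho>)"
proof -
  obtain N where N: "{t. \<not> (0 < t \<longrightarrow> P t)} \<subseteq> N" "emeasure lborel N = 0" "N \<in> sets borel"
    using AE_E[OF assms(1)] by auto
  note \<open>N \<in> sets borel\<close> [measurable]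
  have "AE t in lborel. t \<notin> N"
    using N by (intro AE_not_in) auto
  then have "AE t in lborel. indicator N t * ennreal (1 / t) * indicator {0<..} t = 0"
    by eventually_elim simp
  then have "(\<integral>\<^sup>+t\<in>{0<..}. indicator N t * ennreal (1 / t) \<partial>lborel) = 0"
    by (subst nn_integral_0_iff_AE) simp_all
  then have "(\<integral>\<^sup>+\<rho>\<in>{0<..}. indicator N (c / \<rho>) * ennreal (1 / \<rho>) \<partial>lborel) = 0"
    using \<open>0 < c\<close> by (subst nn_integral_inverse) auto
  then have "AE \<rho> in lborel. indicator N (c / \<rho>) * ennreal (1 / \<rho>) * indicator {0<..} \<rho> = 0"
    by (subst (asm) nn_integral_0_iff_AE) auto
  then show ?thesis
  proof eventually_elim
    fix \<rho> assume *: "indicator N (c / \<rho>) * ennreal (1 / \<rho>) * indicator {0<..} \<rho> = 0"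
    show "0 < \<rho> \<longrightarrow> P (c / \<rho>)"
    proof
      assume "0 < \<rho>"
      with * have "c / \<rho> \<notin> N"
        by (auto simp: ennreal_eq_0_iff)
      moreover have "0 < c / \<rho>"
        using \<open>0 < \<rho>\<close> \<open>0 < c\<close> by simp
      ultimately show "P (c / \<rho>)"
        using N(1) by blast
    qed
  qed
qed

lemma lebesgue_complex_AE_borel:
  fixes f :: "'a::euclidean_space \<Rightarrow> complex"
  assumes [measurable]: "f \<in> borel_measurable lebesgue"
  obtains g where "g \<in> borel_measurable borel" "AE x in lborel. f x = g x"
proof -
  have "(\<lambda>x. Re (f x)) \<in> borel_measurable lebesgue" "(\<lambda>x. Im (f x)) \<in> borel_measurable lebesgue"
    by measurable
  from this[THEN completion_ex_borel_measurable_real]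
  obtain a b where [measurable]: "a \<in> borel_measurable borel" "b \<in> borel_measurable borel"
    and eq: "AE x in lborel. Re (f x) = a x" "AE x in lborel. Im (f x) = b x"
    by auto
  show thesis
  proof
    show "(\<lambda>x. complex_of_real (a x) + \<i> * complex_of_real (b x)) \<in> borel_measurable borel"
      by measurable
    show "AE x in lborel. f x = complex_of_real (a x) + \<i> * complex_of_real (b x)"
      using eq by eventually_elim (simp add: complex_eq_iff)
  qed
qed

lemma radial_value_eq:
  assumes "radial \<Phi>" shows "radial_value \<Phi> (norm x) = \<Phi> x"
  using assms someI[of "\<lambda>y. norm y = norm x" x] unfolding radial_def radial_value_def by blast

text \<open>By Fubini's theorem \<open>\<Phi>\<close> agrees almost everywhere with its Borel version \<open>\<Psi>\<close> along almost every ray;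
  \<open>\<psi>\<close> is \<open>\<Psi>\<close> on one such ray.\<close>
lemma radial_value_AE_borel:
  fixes \<Phi> :: "'a::euclidean_space \<Rightarrow> complex"
  assumes "\<Phi> \<in> borel_measurable lebesgue" "radial \<Phi>"
  obtains \<psi> where "\<psi> \<in> borel_measurable borel" "AE t in lborel. 0 < t \<longrightarrow> radial_value \<Phi> t = \<psi> t"
proof -
  obtain \<Psi> where [measurable]: "\<Psi> \<in> borel_measurable borel" and "AE x in lborel. \<Phi> x = \<Psi> x"
    using assms by (elim lebesgue_complex_AE_borel)
  from AE_polar(2)[OF this(2)]
  obtain \<theta> where \<theta>: "norm \<theta> = 1" "AE t in lborel. 0 < t \<longrightarrow> \<Phi> (t *\<^sub>R \<theta>) = \<Psi> (t *\<^sub>R \<theta>)"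
    by blast
  show thesis
  proof
    show "(\<lambda>t. \<Psi> (t *\<^sub>R \<theta>)) \<in> borel_measurable borel"
      by measurable
    show "AE t in lborel. 0 < t \<longrightarrow> radial_value \<Phi> t = \<Psi> (t *\<^sub>R \<theta>)"
      using \<theta>(2)
    proof eventually_elim
      fix t assume "0 < t \<longrightarrow> \<Phi> (t *\<^sub>R \<theta>) = \<Psi> (t *\<^sub>R \<theta>)"
      then show "0 < t \<longrightarrow> radial_value \<Phi> t = \<Psi> (t *\<^sub>R \<theta>)"
        using radial_value_eq[OF \<open>radial \<Phi>\<close>, of "t *\<^sub>R \<theta>"] \<theta>(1) by auto
    qed
  qed
qed

section \<open>Angular norms and radial means\<close>

text \<open>Taking the root \<open>1 / q\<close> here makes the inner power \<open>p / q\<close> of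
  the Morrey norm a plain \<open>p\<close>-th power of this quantity.\<close>

definition angular_norm :: "real \<Rightarrow> ('a::euclidean_space \<Rightarrow> complex) \<Rightarrow> real \<Rightarrow> ennreal" where
  "angular_norm q f \<rho> = ennreal_powr (\<integral>\<^sup>+\<theta>. ennreal (cmod (f (\<rho> *\<^sub>R \<theta>)) powr q) \<partial>cone_measure) (1 / q)"

lemma borel_measurable_angular_norm [measurable]:
  assumes [measurable]: "f \<in> borel_measurable borel"
  shows "angular_norm q f \<in> borel_measurable borel"
  unfolding angular_norm_def by measurable

text \<open>Jensen's inequality for the cone measure divided by its mass \<omega>. The factor
  \<open>ennreal_powr \<omega> (1 / q)\<close> on the left is the angular norm of the constant 1,
  which appears because the image under the operator is radial; together the two effects give
  exactly the factor \<omega>.\<close>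

lemma angular_mean_le:
  fixes f :: "'a::euclidean_space \<Rightarrow> complex"
  assumes [measurable]: "f \<in> borel_measurable borel" and "1 \<le> q"
  defines "\<omega> \<equiv> emeasure (cone_measure :: 'a measure) UNIV"
  shows "ennreal_powr \<omega> (1 / q) * (\<integral>\<^sup>+\<theta>. ennreal (cmod (f (\<rho> *\<^sub>R \<theta>))) \<partial>cone_measure) \<le> \<omega> * angular_norm q f \<rho>"
proof -
  have \<omega>: "\<omega> * inverse \<omega> = 1"
    unfolding \<omega>_def divide_ennreal_def[symmetric]
    by (rule ennreal_divide_self) (use emeasure_cone_measure_UNIV_pos[where 'a='a]
        cone_measure.emeasure_finite[where 'a='a, of UNIV] in \<open>auto simp only: less_top infinity_ennreal_def\<close>)
  let ?I = "\<integral>\<^sup>+\<theta>. ennreal (cmod (f (\<rho> *\<^sub>R \<theta>))) \<partial>cone_measure"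
  let ?m = "scale_measure (inverse \<omega>) (cone_measure :: 'a measure)"
  have "inverse \<omega> * \<omega> = 1" using \<omega> by (simp add: mult.commute)
  then have "ennreal_powr (\<integral>\<^sup>+\<theta>. ennreal (cmod (f (\<rho> *\<^sub>R \<theta>))) \<partial>?m) q
      \<le> (\<integral>\<^sup>+\<theta>. ennreal_powr (ennreal (cmod (f (\<rho> *\<^sub>R \<theta>)))) q \<partial>?m)"
    using \<open>1 \<le> q\<close> by (intro ennreal_powr_nn_integral_le) (auto simp: \<omega>_def space_scale_measure)
  then have "ennreal_powr (inverse \<omega> * ?I) q
      \<le> inverse \<omega> * (\<integral>\<^sup>+\<theta>. ennreal (cmod (f (\<rho> *\<^sub>R \<theta>)) powr q) \<partial>cone_measure)"
    by (simp add: nn_integral_scale_measure ennreal_powr_ennreal)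
  then have "ennreal_powr (ennreal_powr (inverse \<omega> * ?I) q) (1 / q)
      \<le> ennreal_powr (inverse \<omega> * (\<integral>\<^sup>+\<theta>. ennreal (cmod (f (\<rho> *\<^sub>R \<theta>)) powr q) \<partial>cone_measure)) (1 / q)"
    using \<open>1 \<le> q\<close> by (intro ennreal_powr_mono) auto
  then have "inverse \<omega> * ?I \<le> ennreal_powr (inverse \<omega>) (1 / q) * angular_norm q f \<rho>"
    using \<open>1 \<le> q\<close> by (simp add: ennreal_powr_powr ennreal_powr_mult[of "inverse \<omega>" _ "1/q"] angular_norm_def)
  \<comment> \<open>Multiplication by \<open>\<omega> * ennreal_powr \<omega> (1 / q)\<close> clears
    all inverses, as \<omega> is positive and finite.\<close>
  then have "(\<omega> * ennreal_powr \<omega> (1 / q)) * (inverse \<omega> * ?I)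
      \<le> (\<omega> * ennreal_powr \<omega> (1 / q)) * (ennreal_powr (inverse \<omega>) (1 / q) * angular_norm q f \<rho>)"
    by (intro mult_left_mono) auto
  also have "\<dots> = \<omega> * ennreal_powr (\<omega> * inverse \<omega>) (1 / q) * angular_norm q f \<rho>"
    by (simp only: ennreal_powr_mult ac_simps)
  also have "(\<omega> * ennreal_powr \<omega> (1 / q)) * (inverse \<omega> * ?I) = (\<omega> * inverse \<omega>) * (ennreal_powr \<omega> (1 / q) * ?I)"
    by (simp only: ac_simps)
  finally show ?thesis
    by (simp only: \<omega> ennreal_powr_1 mult_1 mult_1_right)
qed

text \<open>The expression under the supremum of the Morrey norm, without the factor \<open>1 / \<phi> r\<close>: here \<open>v\<close> is the volume
  of the unit ball, \<open>n\<close> the dimension and \<open>g\<close> the angular norm.\<close>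
definition radial_mean :: "real \<Rightarrow> nat \<Rightarrow> real \<Rightarrow> (real \<Rightarrow> ennreal) \<Rightarrow> real \<Rightarrow> ennreal" where
  "radial_mean v n p g r = ennreal_powr
     (ennreal (1 / (v * r ^ n)) * (\<integral>\<^sup>+\<rho>\<in>{0<..<r}. ennreal_powr (g \<rho>) p * ennreal (\<rho> ^ (n - 1)) \<partial>lborel)) (1 / p)"

text \<open>With weight and normalization absorbed into the measure, the mean is an ordinary norm,
  so homogeneity and Minkowski's inequality apply directly.\<close>

lemma radial_mean_density:
  assumes [measurable]: "g \<in> borel_measurable borel"
  shows "radial_mean v n p g r = ennreal_powr (\<integral>\<^sup>+\<rho>. ennreal_powr (g \<rho>) p
    \<partial>density lborel (\<lambda>\<rho>. ennreal (1 / (v * r ^ n)) * (ennreal (\<rho> ^ (n - 1)) * indicator {0<..<r} \<rho>))) (1 / p)"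
proof -
  have "(\<integral>\<^sup>+\<rho>. ennreal_powr (g \<rho>) p
      \<partial>density lborel (\<lambda>\<rho>. ennreal (1 / (v * r ^ n)) * (ennreal (\<rho> ^ (n - 1)) * indicator {0<..<r} \<rho>)))
    = (\<integral>\<^sup>+\<rho>. ennreal (1 / (v * r ^ n)) * (ennreal_powr (g \<rho>) p * ennreal (\<rho> ^ (n - 1)) * indicator {0<..<r} \<rho>) \<partial>lborel)"
    by (subst nn_integral_density) (auto intro!: nn_integral_cong simp: ac_simps)
  then show ?thesis
    by (simp add: radial_mean_def nn_integral_cmult)
qed

lemma borel_measurable_radial_mean [measurable]:
  assumes [measurable]: "g \<in> borel_measurable borel"
  shows "radial_mean v n p g \<in> borel_measurable borel"
  unfolding radial_mean_def greaterThanLessThan_iff indicator_def by measurable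

lemma radial_mean_mono:
  assumes "\<And>\<rho>. 0 < \<rho> \<Longrightarrow> g \<rho> \<le> g' \<rho>" "0 < p"
  shows "radial_mean v n p g r \<le> radial_mean v n p g' r"
  unfolding radial_mean_def using assms
  by (intro ennreal_powr_mono mult_left_mono nn_integral_mono) (auto simp: indicator_def intro!: mult_right_mono ennreal_powr_mono)

lemma radial_mean_cmult:
  assumes [measurable]: "g \<in> borel_measurable borel" and "0 < p"
  shows "radial_mean v n p (\<lambda>\<rho>. c * g \<rho>) r = c * radial_mean v n p g r"
  using \<open>0 < p\<close>
  by (simp add: radial_mean_density ennreal_powr_mult[of c] nn_integral_cmult)
     (simp add: ennreal_powr_mult ennreal_powr_powr)

lemma radial_mean_Minkowski:
  fixes h :: "real \<Rightarrow> real \<Rightarrow> ennreal"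
  assumes [measurable]: "case_prod h \<in> borel_measurable (borel \<Otimes>\<^sub>M borel)" and "1 \<le> p"
  shows "radial_mean v n p (\<lambda>\<rho>. \<integral>\<^sup>+t. h \<rho> t \<partial>lborel) r \<le> (\<integral>\<^sup>+t. radial_mean v n p (\<lambda>\<rho>. h \<rho> t) r \<partial>lborel)"
proof -
  let ?M = "density lborel (\<lambda>\<rho>. ennreal (1 / (v * r ^ n)) * (ennreal (\<rho> ^ (n - 1)) * indicator {0<..<r} \<rho>))"
  have [measurable]: "case_prod h \<in> borel_measurable (lborel \<Otimes>\<^sub>M lborel)" "case_prod h \<in> borel_measurable (?M \<Otimes>\<^sub>M lborel)"
    by measurable
  have [measurable]: "h \<rho> \<in> borel_measurable borel" "(\<lambda>\<rho>. h \<rho> t) \<in> borel_measurable borel" for \<rho> t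
    by measurable
  have "sigma_finite_measure ?M"
    by (subst sigma_finite_measure.sigma_finite_iff_density_finite[OF sigma_finite_lborel])
       (auto simp: ennreal_mult_eq_top_iff indicator_def)
  from nn_integral_Minkowski[OF this sigma_finite_lborel, of h p]
  show ?thesis
    using \<open>1 \<le> p\<close> by (simp add: radial_mean_density)
qed

text \<open>Substituting \<open>\<rho> = t * u\<close> produces \<open>t ^ n\<close>, one factor
  from the differential and \<open>n - 1\<close> from the weight; it turns the normalization for
  \<open>r\<close> into the one for \<open>r / t\<close>.\<close>

lemma radial_mean_scale:
  assumes [measurable]: "g \<in> borel_measurable borel" and "0 < t" "0 < n"
  shows "radial_mean v n p (\<lambda>\<rho>. g (\<rho> / t)) r = radial_mean v n p g (r / t)"
proof -
  let ?I = "\<integral>\<^sup>+u\<in>{0<..<r / t}. ennreal_powr (g u) p * ennreal (u ^ (n - 1)) \<partial>lborel"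
  have "(\<integral>\<^sup>+\<rho>\<in>{0<..<r}. ennreal_powr (g (\<rho> / t)) p * ennreal (\<rho> ^ (n - 1)) \<partial>lborel)
    = ennreal t * (\<integral>\<^sup>+u. ennreal_powr (g u) p * ennreal ((t * u) ^ (n - 1)) * indicator {0<..<r} (t * u) \<partial>lborel)"
    using \<open>0 < t\<close> by (subst nn_integral_real_affine[where c=t and t=0]) simp_all
  also have "(\<integral>\<^sup>+u. ennreal_powr (g u) p * ennreal ((t * u) ^ (n - 1)) * indicator {0<..<r} (t * u) \<partial>lborel)
    = (\<integral>\<^sup>+u. ennreal (t ^ (n - 1)) * (ennreal_powr (g u) p * ennreal (u ^ (n - 1)) * indicator {0<..<r / t} u) \<partial>lborel)"
    using \<open>0 < t\<close>
    by (intro nn_integral_cong)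
       (auto simp: indicator_def power_mult_distrib ennreal_mult ac_simps pos_less_divide_eq zero_less_mult_iff)
  also have "\<dots> = ennreal (t ^ (n - 1)) * ?I"
    by (simp add: nn_integral_cmult)
  also have "ennreal t * (ennreal (t ^ (n - 1)) * ?I) = ennreal (t ^ n) * ?I"
    using \<open>0 < t\<close> \<open>0 < n\<close> by (simp add: power_eq_if[of t n] flip: mult.assoc ennreal_mult)
  finally have *: "(\<integral>\<^sup>+\<rho>\<in>{0<..<r}. ennreal_powr (g (\<rho> / t)) p * ennreal (\<rho> ^ (n - 1)) \<partial>lborel) = ennreal (t ^ n) * ?I" .
  have "ennreal (1 / (v * r ^ n)) * ennreal (t ^ n) = ennreal (1 / (v * (r / t) ^ n))"
    using \<open>0 < t\<close> by (simp add: power_divide flip: ennreal_mult'')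
  then show ?thesis
    unfolding radial_mean_def * by (simp add: mult.assoc[symmetric])
qed

section \<open>The Hausdorff operator\<close>

text \<open>For almost every radius the two functions agree almost everywhere on the sphere. This
  licenses the passage to Borel versions of both \<open>f\<close> and its image.\<close>

lemma morrey_norm_cong_AE:
  fixes f g :: "'a::euclidean_space \<Rightarrow> complex"
  assumes "AE x in lborel. f x = g x"
  shows "morrey_norm \<phi> p q f = morrey_norm \<phi> p q g"
proof -
  have "(\<integral>\<^sup>+\<rho>\<in>{0<..<r}. ennreal_powr (\<integral>\<^sup>+\<theta>. ennreal (cmod (f (\<rho> *\<^sub>R \<theta>)) powr q) \<partial>surface_measure) (p / q)
        * ennreal (\<rho> ^ (DIM('a) - 1)) \<partial>lebesgue)
    = (\<integral>\<^sup>+\<rho>\<in>{0<..<r}. ennreal_powr (\<integral>\<^sup>+\<theta>. ennreal (cmod (g (\<rho> *\<^sub>R \<theta>)) powr q) \<partial>surface_measure) (p / q)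
        * ennreal (\<rho> ^ (DIM('a) - 1)) \<partial>lebesgue)" for r
  proof (rule nn_integral_cong_AE, use AE_completion[OF AE_polar(1)[OF assms]] in eventually_elim)
    fix \<rho> :: real
    assume *: "0 < \<rho> \<longrightarrow> (AE \<theta> in surface_measure. f (\<rho> *\<^sub>R \<theta>) = g (\<rho> *\<^sub>R \<theta>))"
    have "(\<integral>\<^sup>+\<theta>. ennreal (cmod (f (\<rho> *\<^sub>R \<theta>)) powr q) \<partial>surface_measure)
        = (\<integral>\<^sup>+\<theta>. ennreal (cmod (g (\<rho> *\<^sub>R \<theta>)) powr q) \<partial>surface_measure)" if "0 < \<rho>"
      by (rule nn_integral_cong_AE, use *[rule_format, OF that] in eventually_elim) simp
    then show "ennreal_powr (\<integral>\<^sup>+\<theta>. ennreal (cmod (f (\<rho> *\<^sub>R \<theta>)) powr q) \<partial>surface_measure) (p / q)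
          * ennreal (\<rho> ^ (DIM('a) - 1)) * indicator {0<..<r} \<rho>
        = ennreal_powr (\<integral>\<^sup>+\<theta>. ennreal (cmod (g (\<rho> *\<^sub>R \<theta>)) powr q) \<partial>surface_measure) (p / q)
          * ennreal (\<rho> ^ (DIM('a) - 1)) * indicator {0<..<r} \<rho>"
      by (cases "0 < \<rho>") simp_all
  qed
  then show ?thesis
    by (simp only: morrey_norm_def)
qed

lemma morrey_norm_borel:
  fixes f :: "'a::euclidean_space \<Rightarrow> complex"
  assumes [measurable]: "f \<in> borel_measurable borel"
  shows "morrey_norm \<phi> p q f = (SUP r\<in>{0<..}. ennreal (1 / \<phi> r) *
    radial_mean (measure lborel (ball (0::'a) 1)) DIM('a) p (angular_norm q f) r)"
  unfolding morrey_norm_def radial_mean_def angular_norm_def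
  by (simp add: ennreal_powr_powr nn_integral_completion nn_integral_surface_measure)

text \<open>For radial \<open>\<Phi>\<close> the integrand depends on \<open>x\<close> only through
  \<open>R = norm x\<close>; \<open>\<psi>\<close> stands for the profile of
  \<open>\<Phi>\<close>.\<close>

definition hausdorff_kernel :: "(real \<Rightarrow> complex) \<Rightarrow> ('a::euclidean_space \<Rightarrow> complex) \<Rightarrow> real \<Rightarrow> 'a \<Rightarrow> complex" where
  "hausdorff_kernel \<psi> f R y = \<psi> (R / norm y) / complex_of_real (norm y ^ DIM('a)) * f y"

lemma borel_measurable_hausdorff_kernel [measurable]:
  assumes [measurable]: "\<psi> \<in> borel_measurable borel" "f \<in> borel_measurable borel"
  shows "(\<lambda>(R, y). hausdorff_kernel \<psi> f R y) \<in> borel_measurable (borel \<Otimes>\<^sub>M borel)"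
    and "hausdorff_kernel \<psi> f R \<in> borel_measurable borel"
  unfolding hausdorff_kernel_def by measurable

text \<open>In polar coordinates the powers of \<rho> combine to \<open>1 / \<rho>\<close>, so the
  substitution \<open>t = R / \<rho>\<close> is the inversion of \<open>dt / t\<close>.\<close>

lemma hausdorff_kernel_polar:
  fixes f :: "'a::euclidean_space \<Rightarrow> complex"
  assumes [measurable]: "\<psi> \<in> borel_measurable borel" "f \<in> borel_measurable borel" and "0 < R"
  shows "(\<integral>\<^sup>+y. ennreal (cmod (hausdorff_kernel \<psi> f R y)) \<partial>lborel)
    = (\<integral>\<^sup>+t\<in>{0<..}. ennreal (cmod (\<psi> t) / t) * (\<integral>\<^sup>+\<theta>. ennreal (cmod (f ((R / t) *\<^sub>R \<theta>))) \<partial>cone_measure) \<partial>lborel)"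
proof -
  let ?S = "\<lambda>\<rho>. \<integral>\<^sup>+\<theta>. ennreal (cmod (f (\<rho> *\<^sub>R \<theta>))) \<partial>cone_measure"
  let ?F = "\<lambda>t. ennreal (cmod (\<psi> t)) * ?S (R / t)"
  have "(\<integral>\<^sup>+y. ennreal (cmod (hausdorff_kernel \<psi> f R y)) \<partial>lborel)
      = (\<integral>\<^sup>+y. ennreal (cmod (\<psi> (R / norm y)) / norm y ^ DIM('a)) * ennreal (cmod (f y)) \<partial>lborel)"
    by (intro nn_integral_cong)
       (simp add: hausdorff_kernel_def norm_mult norm_divide norm_power flip: ennreal_mult)
  also have "\<dots> = (\<integral>\<^sup>+\<rho>\<in>{0<..}. ennreal (cmod (\<psi> (R / \<rho>)) / \<rho> ^ DIM('a)) * ?S \<rho> * ennreal (\<rho> ^ (DIM('a) - 1)) \<partial>lborel)"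
    by (rule nn_integral_polar_radial) measurable
  also have "\<dots> = (\<integral>\<^sup>+\<rho>\<in>{0<..}. ?F (R / \<rho>) * ennreal (1 / \<rho>) \<partial>lborel)"
  proof (rule nn_integral_cong)
    fix \<rho> :: real
    show "ennreal (cmod (\<psi> (R / \<rho>)) / \<rho> ^ DIM('a)) * ?S \<rho> * ennreal (\<rho> ^ (DIM('a) - 1)) * indicator {0<..} \<rho>
        = ?F (R / \<rho>) * ennreal (1 / \<rho>) * indicator {0<..} \<rho>"
    proof (cases "0 < \<rho>")
      case True
      have "R / (R / \<rho>) = \<rho>"
        using True \<open>0 < R\<close> by simp
      moreover have "ennreal (cmod (\<psi> (R / \<rho>)) / \<rho> ^ DIM('a)) * ennreal (\<rho> ^ (DIM('a) - 1))
          = ennreal (cmod (\<psi> (R / \<rho>))) * ennreal (1 / \<rho>)"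
        using True by (simp add: power_eq_if[of \<rho> "DIM('a)"] flip: ennreal_mult)
      moreover have "ennreal (cmod (\<psi> (R / \<rho>)) / \<rho> ^ DIM('a)) * ?S \<rho> * ennreal (\<rho> ^ (DIM('a) - 1)) * indicator {0<..} \<rho>
          = (ennreal (cmod (\<psi> (R / \<rho>)) / \<rho> ^ DIM('a)) * ennreal (\<rho> ^ (DIM('a) - 1))) * (?S \<rho> * indicator {0<..} \<rho>)"
        by (simp only: ac_simps)
      ultimately show ?thesis
        by (simp only: mult.assoc mult.left_commute[of "ennreal (1 / \<rho>)"])
    qed simp
  qed
  also have "\<dots> = (\<integral>\<^sup>+t\<in>{0<..}. ?F t * ennreal (1 / t) \<partial>lborel)"
    using \<open>0 < R\<close> by (intro nn_integral_inverse) measurable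
  also have "\<dots> = (\<integral>\<^sup>+t\<in>{0<..}. ennreal (cmod (\<psi> t) / t) * ?S (R / t) \<partial>lborel)"
  proof (rule nn_integral_cong)
    fix t :: real
    have "ennreal (cmod (\<psi> t) / t) = ennreal (cmod (\<psi> t)) * ennreal (1 / t)" if "0 < t"
      using that by (simp flip: ennreal_mult)
    then show "?F t * ennreal (1 / t) * indicator {0<..} t
        = ennreal (cmod (\<psi> t) / t) * ?S (R / t) * indicator {0<..} t"
      by (cases "0 < t") (simp_all add: ac_simps)
  qed
  finally show ?thesis .
qed

text \<open>The central estimate, still free of \<phi>: the angular mean inequality inside the
  integral, then Minkowski's inequality in the radius, then scaling for each
  \<open>t\<close>.\<close>

lemma radial_mean_hausdorff_kernel_le:
  fixes f :: "'a::euclidean_space \<Rightarrow> complex"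
  assumes [measurable]: "\<psi> \<in> borel_measurable borel" "f \<in> borel_measurable borel"
    and "1 \<le> p" "1 \<le> q" "0 < n"
  defines "\<omega> \<equiv> emeasure (cone_measure :: 'a measure) UNIV"
  shows "radial_mean v n p (\<lambda>R. ennreal_powr \<omega> (1 / q) * (\<integral>\<^sup>+y. ennreal (cmod (hausdorff_kernel \<psi> f R y)) \<partial>lborel)) r
    \<le> \<omega> * (\<integral>\<^sup>+t\<in>{0<..}. ennreal (cmod (\<psi> t) / t) * radial_mean v n p (angular_norm q f) (r / t) \<partial>lborel)"
proof -
  let ?c = "\<lambda>t. \<omega> * (ennreal (cmod (\<psi> t) / t) * indicator {0<..} t)"
  have "radial_mean v n p (\<lambda>R. ennreal_powr \<omega> (1 / q) * (\<integral>\<^sup>+y. ennreal (cmod (hausdorff_kernel \<psi> f R y)) \<partial>lborel)) r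
      \<le> radial_mean v n p (\<lambda>R. \<integral>\<^sup>+t. ?c t * angular_norm q f (R / t) \<partial>lborel) r"
  proof (rule radial_mean_mono)
    fix R :: real assume "0 < R"
    let ?S = "\<lambda>\<rho>. \<integral>\<^sup>+\<theta>. ennreal (cmod (f (\<rho> *\<^sub>R \<theta>))) \<partial>cone_measure"
    have "ennreal_powr \<omega> (1 / q) * (\<integral>\<^sup>+y. ennreal (cmod (hausdorff_kernel \<psi> f R y)) \<partial>lborel)
        = (\<integral>\<^sup>+t. ennreal_powr \<omega> (1 / q) * (ennreal (cmod (\<psi> t) / t) * ?S (R / t) * indicator {0<..} t) \<partial>lborel)"
      using \<open>0 < R\<close> by (subst hausdorff_kernel_polar) (simp_all add: nn_integral_cmult)
    also have "\<dots> = (\<integral>\<^sup>+t. (ennreal (cmod (\<psi> t) / t) * indicator {0<..} t) * (ennreal_powr \<omega> (1 / q) * ?S (R / t)) \<partial>lborel)"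
      by (simp only: ac_simps)
    also have "\<dots> \<le> (\<integral>\<^sup>+t. (ennreal (cmod (\<psi> t) / t) * indicator {0<..} t) * (\<omega> * angular_norm q f (R / t)) \<partial>lborel)"
      unfolding \<omega>_def by (intro nn_integral_mono mult_left_mono angular_mean_le assms) auto
    also have "\<dots> = (\<integral>\<^sup>+t. ?c t * angular_norm q f (R / t) \<partial>lborel)"
      by (simp only: ac_simps)
    finally show "ennreal_powr \<omega> (1 / q) * (\<integral>\<^sup>+y. ennreal (cmod (hausdorff_kernel \<psi> f R y)) \<partial>lborel)
        \<le> (\<integral>\<^sup>+t. ?c t * angular_norm q f (R / t) \<partial>lborel)" .
  qed (use \<open>1 \<le> p\<close> in simp)
  also have "\<dots> \<le> (\<integral>\<^sup>+t. radial_mean v n p (\<lambda>R. ?c t * angular_norm q f (R / t)) r \<partial>lborel)"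
    using \<open>1 \<le> p\<close> by (intro radial_mean_Minkowski) measurable
  also have "\<dots> = (\<integral>\<^sup>+t. \<omega> * (ennreal (cmod (\<psi> t) / t) * radial_mean v n p (angular_norm q f) (r / t) * indicator {0<..} t) \<partial>lborel)"
  proof (rule nn_integral_cong)
    fix t :: real
    have "radial_mean v n p (\<lambda>R. ?c t * angular_norm q f (R / t)) r = ?c t * radial_mean v n p (\<lambda>R. angular_norm q f (R / t)) r"
      using \<open>1 \<le> p\<close> by (intro radial_mean_cmult) auto
    then show "radial_mean v n p (\<lambda>R. ?c t * angular_norm q f (R / t)) r
        = \<omega> * (ennreal (cmod (\<psi> t) / t) * radial_mean v n p (angular_norm q f) (r / t) * indicator {0<..} t)"
      using \<open>0 < n\<close> by (cases "0 < t") (simp_all add: radial_mean_scale[of "angular_norm q f"] ac_simps)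
  qed
  also have "\<dots> = \<omega> * (\<integral>\<^sup>+t\<in>{0<..}. ennreal (cmod (\<psi> t) / t) * radial_mean v n p (angular_norm q f) (r / t) \<partial>lborel)"
    by (rule nn_integral_cmult) measurable
  finally show ?thesis .
qed

text \<open>Since \<open>J\<close> need not be measurable, \<open>nn_integral_cmult\<close> is only available for \<open>u / c\<close>.\<close>
lemma nn_integral_le_cmult_lower:
  assumes [measurable]: "u \<in> borel_measurable M" and "c \<noteq> top" and le: "AE x in M. u x \<le> c * J x"
  shows "(\<integral>\<^sup>+x. u x \<partial>M) \<le> c * (\<integral>\<^sup>+x. J x \<partial>M)"
proof (cases "c = 0")
  case True
  with le have "AE x in M. u x = 0" by simp
  then have "(\<integral>\<^sup>+x. u x \<partial>M) = 0" by (subst nn_integral_0_iff_AE) auto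
  then show ?thesis by simp
next
  case False
  have cancel: "a * c / c = a" for a
    using False \<open>c \<noteq> top\<close> by (simp add: mult_divide_eq_ennreal)
  have "(\<integral>\<^sup>+x. u x \<partial>M) = (\<integral>\<^sup>+x. c * (u x / c) \<partial>M)"
    using cancel by (simp add: ennreal_times_divide mult.commute[of c])
  also have "\<dots> = c * (\<integral>\<^sup>+x. u x / c \<partial>M)"
    by (rule nn_integral_cmult) measurable
  also have "\<dots> \<le> c * (\<integral>\<^sup>+x. J x \<partial>M)"
  proof (intro mult_left_mono nn_integral_mono_AE)
    show "AE x in M. u x / c \<le> J x"
      using le
    proof eventually_elim
      fix x assume "u x \<le> c * J x"
      then have "u x / c \<le> J x * c / c"
        by (intro divide_right_mono_ennreal) (simp add: mult.commute)
      then show "u x / c \<le> J x" by (simp only: cancel)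
    qed
  qed simp
  finally show ?thesis .
qed

text \<open>Normalization and weight are positive on the interval, so an infinite value of
  \<open>g\<close> on a set of positive measure would make the mean infinite.\<close>

lemma radial_mean_finite_AE:
  assumes [measurable]: "g \<in> borel_measurable borel" and "radial_mean v n p g r \<noteq> top" "0 < v" "0 < r"
  shows "AE \<rho> in lborel. 0 < \<rho> \<and> \<rho> < r \<longrightarrow> g \<rho> \<noteq> top"
proof -
  have "ennreal (1 / (v * r ^ n)) \<noteq> 0"
    using assms by (simp add: ennreal_eq_0_iff not_le)
  then have "(\<integral>\<^sup>+\<rho>\<in>{0<..<r}. ennreal_powr (g \<rho>) p * ennreal (\<rho> ^ (n - 1)) \<partial>lborel) \<noteq> \<infinity>"
    using assms(2) by (simp add: radial_mean_def ennreal_mult_eq_top_iff)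
  then have "AE \<rho> in lborel. ennreal_powr (g \<rho>) p * ennreal (\<rho> ^ (n - 1)) * indicator {0<..<r} \<rho> \<noteq> \<infinity>"
    by (intro nn_integral_PInf_AE) measurable
  then show ?thesis
  proof eventually_elim
    fix \<rho> :: real
    assume *: "ennreal_powr (g \<rho>) p * ennreal (\<rho> ^ (n - 1)) * indicator {0<..<r} \<rho> \<noteq> \<infinity>"
    show "0 < \<rho> \<and> \<rho> < r \<longrightarrow> g \<rho> \<noteq> top"
    proof (intro impI notI)
      assume "0 < \<rho> \<and> \<rho> < r" "g \<rho> = top"
      then have "ennreal (\<rho> ^ (n - 1)) \<noteq> 0" "indicator {0<..<r} \<rho> = (1 :: ennreal)"
        by (simp_all add: ennreal_eq_0_iff not_le)
      with * \<open>g \<rho> = top\<close> show False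
        by (simp add: ennreal_top_mult)
    qed
  qed
qed

text \<open>The estimate is proved for the integral of the absolute value of the kernel. It
  therefore yields both the norm bound and, through its finiteness, the almost everywhere existence
  of the integral defining the operator.\<close>

lemma morrey_norm_hausdorff_op:
  fixes \<Phi> f :: "'a::euclidean_space \<Rightarrow> complex"
  assumes p: "1 \<le> p" and q: "1 \<le> q" and pos: "\<forall>t>0. 0 < \<phi> t"
    and \<Phi>: "\<Phi> \<in> borel_measurable lebesgue" "radial \<Phi>"
    and K: "hausdorff_const \<phi> \<Phi> < \<infinity>" and f: "f \<in> morrey_space \<phi> p q"
  shows "AE x in lebesgue. integrable lebesgue (hausdorff_integrand \<Phi> f x)"
    and "hausdorff_op \<Phi> f \<in> borel_measurable lebesgue"
    and "morrey_norm \<phi> p q (hausdorff_op \<Phi> f) \<le> hausdorff_const \<phi> \<Phi> * morrey_norm \<phi> p q f"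
proof -
  have \<phi>: "0 < \<phi> t" if "0 < t" for t
    using pos that by blast
  define \<omega> where "\<omega> = emeasure (cone_measure :: 'a measure) UNIV"
  define v where "v = measure lborel (ball (0::'a) 1)"
  have v: "0 < v"
    unfolding v_def by (rule content_ball_pos) simp
  have \<omega>: "\<omega> \<noteq> 0"
    using emeasure_cone_measure_UNIV_pos[where 'a='a] by (simp add: \<omega>_def zero_less_iff_neq_zero)
  have f_meas: "f \<in> borel_measurable lebesgue" and f_fin: "morrey_norm \<phi> p q f < \<infinity>"
    using f by (auto simp: morrey_space_def)

  \<comment> \<open>Borel versions of the data\<close>
  obtain g where g [measurable]: "g \<in> borel_measurable borel" and fg: "AE x in lborel. f x = g x"
    using f_meas by (rule lebesgue_complex_AE_borel)
  obtain \<psi> where \<psi> [measurable]: "\<psi> \<in> borel_measurable borel"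
    and \<Phi>\<psi>: "AE t in lborel. 0 < t \<longrightarrow> radial_value \<Phi> t = \<psi> t"
    using \<Phi> by (rule radial_value_AE_borel)
  define N where "N = morrey_norm \<phi> p q g"
  have N: "N = morrey_norm \<phi> p q f" "N \<noteq> top"
    using morrey_norm_cong_AE[OF fg] f_fin by (auto simp: N_def)
  define M where "M = radial_mean v DIM('a) p (angular_norm q g)"
  define A where "A R = (\<integral>\<^sup>+y. ennreal (cmod (hausdorff_kernel \<psi> g R y)) \<partial>lborel)" for R
  define h where "h R = (\<integral>y. hausdorff_kernel \<psi> g R y \<partial>lborel)" for R
  have [measurable]: "A \<in> borel_measurable borel" "h \<in> borel_measurable borel"
    unfolding A_def h_def by measurable

  \<comment> \<open>The image as a radial function\<close>
  have kernel: "AE y in lebesgue. hausdorff_integrand \<Phi> f x y = hausdorff_kernel \<psi> g (norm x) y" if "x \<noteq> 0" for x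
  proof (rule AE_completion)
    \<comment> \<open>The exceptional \<open>t\<close> are pulled back first under
      \<open>t = norm x / \<rho>\<close>, then under \<open>\<rho> = norm y\<close>.\<close>
    have "AE y in lborel. y \<noteq> (0::'a) \<longrightarrow> radial_value \<Phi> (norm x / norm y) = \<psi> (norm x / norm y)"
      using that by (intro AE_norm AE_inverse[OF \<Phi>\<psi>]) auto
    then show "AE y in lborel. hausdorff_integrand \<Phi> f x y = hausdorff_kernel \<psi> g (norm x) y"
      using fg AE_lborel_singleton[of 0]
    proof eventually_elim
      fix y :: 'a
      assume y: "y \<noteq> 0 \<longrightarrow> radial_value \<Phi> (norm x / norm y) = \<psi> (norm x / norm y)" "f y = g y" "y \<noteq> 0"
      have "norm (inverse (norm y) *\<^sub>R x) = norm x / norm y"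
        by (simp add: field_simps)
      then have "\<Phi> (inverse (norm y) *\<^sub>R x) = \<psi> (norm x / norm y)"
        using y radial_value_eq[OF \<Phi>(2), of "inverse (norm y) *\<^sub>R x"] by simp
      then show "hausdorff_integrand \<Phi> f x y = hausdorff_kernel \<psi> g (norm x) y"
        using y by (simp add: hausdorff_integrand_def hausdorff_kernel_def)
    qed
  qed
  have kernel_meas: "hausdorff_kernel \<psi> g R \<in> borel_measurable lebesgue" for R
    by (intro measurable_completion) simp
  \<comment> \<open>A Lebesgue measurable \<open>\<Phi>\<close> composed with a map of
    \<open>y\<close> is not measurable for free; here it follows from almost everywhere equality
    with the Borel kernel.\<close>
  have integrand_meas: "hausdorff_integrand \<Phi> f x \<in> borel_measurable lebesgue" if "x \<noteq> 0" for x
    using kernel_meas by (rule borel_measurable_AE) (use kernel[OF that] in eventually_elim, simp)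
  have op_eq: "hausdorff_op \<Phi> f x = h (norm x)" if "x \<noteq> 0" for x
  proof -
    have "hausdorff_op \<Phi> f x = (\<integral>y. hausdorff_kernel \<psi> g (norm x) y \<partial>lebesgue)"
      unfolding hausdorff_op_def
      by (rule integral_cong_AE[OF integrand_meas[OF that] kernel_meas kernel[OF that]])
    then show ?thesis
      by (simp add: h_def integral_completion)
  qed
  have AE_nz: "AE x in lborel. x \<noteq> (0::'a)"
    by (rule AE_lborel_singleton)
  have op_AE: "AE x in lborel. hausdorff_op \<Phi> f x = h (norm x)"
    using AE_nz by eventually_elim (rule op_eq)
  show "hausdorff_op \<Phi> f \<in> borel_measurable lebesgue"
  proof (rule borel_measurable_AE)
    show "(\<lambda>x::'a. h (norm x)) \<in> borel_measurable lebesgue"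
      by (intro measurable_completion) simp
    show "AE x in lebesgue. h (norm x) = hausdorff_op \<Phi> f x"
      using AE_completion[OF op_AE] by eventually_elim simp
  qed

  \<comment> \<open>Bounds for the radial means\<close>
  have M_le: "M s \<le> N * ennreal (\<phi> s)" if "0 < s" for s
  proof -
    have "ennreal (1 / \<phi> s) * M s \<le> N"
      unfolding N_def morrey_norm_borel[OF g] M_def v_def using that by (intro SUP_upper) auto
    then have "ennreal (\<phi> s) * (ennreal (1 / \<phi> s) * M s) \<le> ennreal (\<phi> s) * N"
      by (rule mult_left_mono) simp
    moreover have "ennreal (\<phi> s) * ennreal (1 / \<phi> s) = 1"
      using \<phi>[OF that] by (simp flip: ennreal_mult)
    ultimately show ?thesis
      by (simp only: mult.assoc[symmetric] mult_1 mult.commute[of N])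
  qed
  define J where "J r = (\<integral>\<^sup>+t\<in>{0<..}. ennreal (cmod (radial_value \<Phi> t) / t * \<phi> (r / t)) \<partial>lebesgue)" for r
  \<comment> \<open>Replacing \<open>lebesgue\<close> by \<open>lborel\<close> in \<open>J\<close>
    is valid for arbitrary integrands: the lower integral does not change under completion.\<close>
  have lower: "(\<integral>\<^sup>+t\<in>{0<..}. ennreal (cmod (\<psi> t) / t) * M (r / t) \<partial>lborel) \<le> N * J r" if "0 < r" for r
    unfolding J_def nn_integral_completion
  proof (rule nn_integral_le_cmult_lower)
    show "AE t in lborel. ennreal (cmod (\<psi> t) / t) * M (r / t) * indicator {0<..} t
        \<le> N * (ennreal (cmod (radial_value \<Phi> t) / t * \<phi> (r / t)) * indicator {0<..} t)"
      using \<Phi>\<psi>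
    proof eventually_elim
      fix t assume *: "0 < t \<longrightarrow> radial_value \<Phi> t = \<psi> t"
      show "ennreal (cmod (\<psi> t) / t) * M (r / t) * indicator {0<..} t
          \<le> N * (ennreal (cmod (radial_value \<Phi> t) / t * \<phi> (r / t)) * indicator {0<..} t)"
      proof (cases "0 < t")
        case True
        have "ennreal (cmod (\<psi> t) / t) * M (r / t) \<le> ennreal (cmod (\<psi> t) / t) * (N * ennreal (\<phi> (r / t)))"
          using True that by (intro mult_left_mono M_le) auto
        also have "\<dots> = N * ennreal (cmod (\<psi> t) / t * \<phi> (r / t))"
        proof -
          have "ennreal (cmod (\<psi> t) / t * \<phi> (r / t)) = ennreal (cmod (\<psi> t) / t) * ennreal (\<phi> (r / t))"
            using True \<phi>[of "r / t"] that by (intro ennreal_mult) auto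
          then show ?thesis by (simp only: ac_simps)
        qed
        finally show ?thesis using True * by simp
      qed simp
    qed
  qed (use N in \<open>simp_all add: M_def\<close>)
  have bound: "ennreal (1 / \<phi> r) * radial_mean v DIM('a) p (\<lambda>R. ennreal_powr \<omega> (1 / q) * A R) r
      \<le> hausdorff_const \<phi> \<Phi> * N" if "0 < r" for r
  proof -
    have "radial_mean v DIM('a) p (\<lambda>R. ennreal_powr \<omega> (1 / q) * A R) r
        \<le> \<omega> * (\<integral>\<^sup>+t\<in>{0<..}. ennreal (cmod (\<psi> t) / t) * M (r / t) \<partial>lborel)"
      unfolding A_def \<omega>_def M_def using p q by (intro radial_mean_hausdorff_kernel_le) auto
    also have "\<dots> \<le> \<omega> * (N * J r)"
      by (intro mult_left_mono lower that) simp
    finally have "ennreal (1 / \<phi> r) * radial_mean v DIM('a) p (\<lambda>R. ennreal_powr \<omega> (1 / q) * A R) r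
        \<le> ennreal (1 / \<phi> r) * (\<omega> * (N * J r))"
      by (rule mult_left_mono) simp
    also have "\<dots> = \<omega> * (ennreal (1 / \<phi> r) * J r) * N"
      by (simp only: ac_simps)
    also have "\<dots> \<le> \<omega> * (SUP r\<in>{0<..}. ennreal (1 / \<phi> r) * J r) * N"
      using that by (intro mult_right_mono mult_left_mono SUP_upper) auto
    also have "\<dots> = hausdorff_const \<phi> \<Phi> * N"
      by (simp add: hausdorff_const_def J_def \<omega>_def emeasure_surface_measure_sphere)
    finally show ?thesis .
  qed

  \<comment> \<open>The norm estimate\<close>
  have h_le: "ennreal (cmod (h R)) \<le> A R" for R
  proof (cases "integrable lborel (hausdorff_kernel \<psi> g R)")
    case True
    then show ?thesis
      unfolding h_def A_def by (rule integral_norm_bound_ennreal)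
  next
    \<comment> \<open>The Bochner integral of a non-integrable function is 0 by convention, so the
      bound is available before integrability is known.\<close>
    case False
    then show ?thesis
      by (simp add: h_def not_integrable_integral_eq)
  qed
  have ang: "angular_norm q (\<lambda>x::'a. h (norm x)) R \<le> ennreal_powr \<omega> (1 / q) * A R" if "0 < R" for R
  proof -
    have "nn_integral cone_measure (\<lambda>\<theta>::'a. ennreal (cmod (h (norm (R *\<^sub>R \<theta>))) powr q))
        = nn_integral cone_measure (\<lambda>_::'a. ennreal (cmod (h R) powr q))"
      by (rule nn_integral_cong_AE, use cone_measure_AE_norm in eventually_elim) (use that in simp)
    also have "\<dots> = ennreal_powr (ennreal (cmod (h R))) q * \<omega>"
      by (simp add: ennreal_powr_ennreal \<omega>_def)
    finally have "angular_norm q (\<lambda>x::'a. h (norm x)) R = ennreal_powr \<omega> (1 / q) * ennreal (cmod (h R))"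
      using q by (simp add: angular_norm_def ennreal_powr_mult ennreal_powr_powr mult.commute)
    then show ?thesis
      by (simp add: h_le mult_left_mono)
  qed
  show "morrey_norm \<phi> p q (hausdorff_op \<Phi> f) \<le> hausdorff_const \<phi> \<Phi> * morrey_norm \<phi> p q f"
  proof -
    have [measurable]: "(\<lambda>x::'a. h (norm x)) \<in> borel_measurable borel"
      by measurable
    have "morrey_norm \<phi> p q (hausdorff_op \<Phi> f) = morrey_norm \<phi> p q (\<lambda>x::'a. h (norm x))"
      by (rule morrey_norm_cong_AE[OF op_AE])
    also have "\<dots> = (SUP r\<in>{0<..}. ennreal (1 / \<phi> r) * radial_mean v DIM('a) p (angular_norm q (\<lambda>x::'a. h (norm x))) r)"
      unfolding v_def by (rule morrey_norm_borel) measurable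
    also have "\<dots> \<le> hausdorff_const \<phi> \<Phi> * N"
    proof (rule SUP_least)
      fix r :: real assume "r \<in> {0<..}"
      have "ennreal (1 / \<phi> r) * radial_mean v DIM('a) p (angular_norm q (\<lambda>x::'a. h (norm x))) r
          \<le> ennreal (1 / \<phi> r) * radial_mean v DIM('a) p (\<lambda>R. ennreal_powr \<omega> (1 / q) * A R) r"
        using p by (intro mult_left_mono radial_mean_mono ang) auto
      also have "\<dots> \<le> hausdorff_const \<phi> \<Phi> * N"
        using \<open>r \<in> {0<..}\<close> by (intro bound) simp
      finally show "ennreal (1 / \<phi> r) * radial_mean v DIM('a) p (angular_norm q (\<lambda>x::'a. h (norm x))) r
          \<le> hausdorff_const \<phi> \<Phi> * N" .
    qed
    finally show ?thesis by (simp add: N)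
  qed

  \<comment> \<open>Absolute convergence\<close>
  have A_fin: "AE R in lborel. 0 < R \<longrightarrow> A R \<noteq> top"
  proof -
    \<comment> \<open>The bound at radius \<open>Suc k\<close>, positive also for
      \<open>k = 0\<close>, gives finiteness below that radius; countably many radii exhaust the
      half-line.\<close>
    have "AE R in lborel. 0 < R \<and> R < real (Suc k) \<longrightarrow> ennreal_powr \<omega> (1 / q) * A R \<noteq> top" for k
    proof (rule radial_mean_finite_AE)
      let ?r = "real (Suc k)"
      have "ennreal (1 / \<phi> ?r) * radial_mean v DIM('a) p (\<lambda>R. ennreal_powr \<omega> (1 / q) * A R) ?r \<noteq> top"
      proof -
        have "hausdorff_const \<phi> \<Phi> * N < top"
          using K N by (simp add: ennreal_mult_less_top less_top)
        with bound[of ?r] show ?thesis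
          by (auto simp: top_unique)
      qed
      moreover have "ennreal (1 / \<phi> ?r) \<noteq> 0"
        using \<phi>[of ?r] by (simp add: ennreal_eq_0_iff not_le)
      ultimately show "radial_mean v DIM('a) p (\<lambda>R. ennreal_powr \<omega> (1 / q) * A R) ?r \<noteq> top"
        by (auto simp: ennreal_mult_eq_top_iff)
    qed (use v in simp_all)
    then have "AE R in lborel. \<forall>k. 0 < R \<and> R < real (Suc k) \<longrightarrow> ennreal_powr \<omega> (1 / q) * A R \<noteq> top"
      by (simp only: AE_all_countable) blast
    then show ?thesis
    proof eventually_elim
      fix R :: real
      assume *: "\<forall>k. 0 < R \<and> R < real (Suc k) \<longrightarrow> ennreal_powr \<omega> (1 / q) * A R \<noteq> top"
      obtain k where "R < real k" using reals_Archimedean2 by blast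
      then have "R < real (Suc k)" by simp
      with * show "0 < R \<longrightarrow> A R \<noteq> top"
        using \<omega> by (auto simp: ennreal_mult_eq_top_iff)
    qed
  qed
  show "AE x in lebesgue. integrable lebesgue (hausdorff_integrand \<Phi> f x)"
  proof (rule AE_completion)
    show "AE x in lborel. integrable lebesgue (hausdorff_integrand \<Phi> f x)"
      using AE_norm[OF A_fin] AE_nz
    proof eventually_elim
      fix x :: 'a assume "x \<noteq> 0 \<longrightarrow> A (norm x) \<noteq> top" and "x \<noteq> 0"
      then have "integrable lborel (hausdorff_kernel \<psi> g (norm x))"
        by (intro integrableI_bounded) (simp_all add: A_def less_top)
      then have "integrable lebesgue (hausdorff_kernel \<psi> g (norm x))"
        by (subst integrable_completion) simp_all
      then show "integrable lebesgue (hausdorff_integrand \<Phi> f x)"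
        by (rule integrable_cong_AE_imp[OF _ integrand_meas[OF \<open>x \<noteq> 0\<close>]])
           (use kernel[OF \<open>x \<noteq> 0\<close>] in eventually_elim, simp)
    qed
  qed
qed

theorem theorem5p3:
  fixes p q :: real
    and \<phi> :: "real \<Rightarrow> real"
    and \<Phi> :: "real ^ 'n \<Rightarrow> complex"
  assumes "CARD('n) \<ge> 2"
    and "p \<ge> 1" and "q \<ge> 1"
    and "\<And>t. t > 0 \<Longrightarrow> \<phi> t > 0"
    and "\<Phi> \<in> borel_measurable lebesgue" and "radial \<Phi>"
    and "hausdorff_const \<phi> \<Phi> < \<infinity>"
  shows "\<forall>f \<in> morrey_space \<phi> p q.
           (AE x in lebesgue. integrable lebesgue (hausdorff_integrand \<Phi> f x)) \<and>
           hausdorff_op \<Phi> f \<in> morrey_space \<phi> p q \<and>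
           morrey_norm \<phi> p q (hausdorff_op \<Phi> f) \<le> hausdorff_const \<phi> \<Phi> * morrey_norm \<phi> p q f"
proof
  fix f :: "real ^ 'n \<Rightarrow> complex" assume f: "f \<in> morrey_space \<phi> p q"
  have "\<forall>t>0. 0 < \<phi> t"
    using assms(4) by blast
  note * = morrey_norm_hausdorff_op[OF assms(2,3) this assms(5-7) f]
  \<comment> \<open>Both factors are finite, so the norm bound also places the image in the
    space.\<close>
  have "hausdorff_const \<phi> \<Phi> * morrey_norm \<phi> p q f < \<infinity>"
    using f assms(7) by (simp add: morrey_space_def ennreal_mult_less_top)
  then have "morrey_norm \<phi> p q (hausdorff_op \<Phi> f) < \<infinity>"
    by (rule le_less_trans[OF *(3)])
  with * show "(AE x in lebesgue. integrable lebesgue (hausdorff_integrand \<Phi> f x)) \<and>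
      hausdorff_op \<Phi> f \<in> morrey_space \<phi> p q \<and>
      morrey_norm \<phi> p q (hausdorff_op \<Phi> f) \<le> hausdorff_const \<phi> \<Phi> * morrey_norm \<phi> p q f"
    by (simp add: morrey_space_def)
qed

end
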